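(* Let $p$ be a prime, let $G$ be a finite $p$-group with $m=\log_p(|G|)$, let $R$ be a commutative ring, let $M$ be an $RG$-module and let $N$ be an $RG$-submodule of $M$ with $\operatorname{Ann}_N(p)=\{x\in N\mid px=0\}=\{0\}$. Let $n\ge 1$ and $r\ge 2m$. Then there is a splitting \[ H^n(G,M/p^rN)\;\cong\; H^n(G,M)\oplus H^{n+1}(G,N) \] which is natural with respect to restriction to subgroups of $G$; that is, there are $R$-module isomorphisms $\Phi_H\colon H^n(H,M/p^rN)\to H^n(H,M)\oplus H^{n+1}(H,N)$ for all subgroups $H\le G$ such that, for all $H'\le H\le G$, the isomorphisms $\Phi_H$ and $\Phi_{H'}$ commute with the restriction maps from $H$ to $H'$.
   Context: $H^n(G,-)$ denotes ordinary group cohomology, and $p^rN=\{p^rx\mid x\in N\}\subseteq M$. *)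

theory Defs
  imports "HOL-Algebra.Module" "HOL-Algebra.Chinese_Remainder" "HOL-Computational_Algebra.Primes"
begin

text \<open>
  An RG-module is an R-module together with an R-linear action of the group G. For an action
  of a subgroup the same map \<open>act\<close> is used; its values outside the group do not matter.
\<close>

locale rg_module = module R M + group G
  for R :: "('r, 'a) ring_scheme" and G :: "('g, 'b) monoid_scheme"
    and M :: "('r, 'm, 'c) module_scheme" and act :: "'g \<Rightarrow> 'm \<Rightarrow> 'm" +
  assumes act_closed: "\<lbrakk>g \<in> carrier G; x \<in> carrier M\<rbrakk> \<Longrightarrow> act g x \<in> carrier M"
    and act_add: "\<lbrakk>g \<in> carrier G; x \<in> carrier M; y \<in> carrier M\<rbrakk>
          \<Longrightarrow> act g (x \<oplus>\<^bsub>M\<^esub> y) = act g x \<oplus>\<^bsub>M\<^esub> act g y"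
    and act_smult: "\<lbrakk>g \<in> carrier G; a \<in> carrier R; x \<in> carrier M\<rbrakk>
          \<Longrightarrow> act g (a \<odot>\<^bsub>M\<^esub> x) = a \<odot>\<^bsub>M\<^esub> act g x"
    and act_one: "x \<in> carrier M \<Longrightarrow> act \<one>\<^bsub>G\<^esub> x = x"
    and act_mult: "\<lbrakk>g \<in> carrier G; h \<in> carrier G; x \<in> carrier M\<rbrakk>
          \<Longrightarrow> act (g \<otimes>\<^bsub>G\<^esub> h) x = act g (act h x)"

locale rg_submodule = submodule N R M
  for N :: "'m set" and R :: "('r, 'a) ring_scheme" and G :: "('g, 'b) monoid_scheme"
    and M :: "('r, 'm, 'c) module_scheme" and act :: "'g \<Rightarrow> 'm \<Rightarrow> 'm" +
  assumes act_stable: "\<lbrakk>g \<in> carrier G; x \<in> N\<rbrakk> \<Longrightarrow> act g x \<in> N"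

text \<open>
  The library's modules are records extending rings; only the additive part and the scalar
  multiplication of such a record matter, so the ring multiplication and the ring unit of the
  modules constructed below have no meaning.
\<close>

text \<open>
  The map of cosets induced by f, with values in the cosets of K in M. If f is additive and maps
  the subgroup of which C is a coset into K, the union below is over equal cosets.
\<close>

definition coset_map :: "('r, 'm, 'c) module_scheme \<Rightarrow> 'm set \<Rightarrow> ('k \<Rightarrow> 'm) \<Rightarrow> 'k set \<Rightarrow> 'm set" where
  "coset_map M K f C = (\<Union>x\<in>C. K +>\<^bsub>M\<^esub> f x)"

definition quot_module :: "('r, 'm, 'c) module_scheme \<Rightarrow> 'm set \<Rightarrow> ('r, 'm set) module" where
  "quot_module M K =
    \<lparr>carrier = a_rcosets\<^bsub>M\<^esub> K, monoid.mult = undefined, one = undefined, zero = K, add = set_add M,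
     smult = (\<lambda>a. coset_map M K (\<lambda>x. a \<odot>\<^bsub>M\<^esub> x))\<rparr>"

definition quot_act :: "('r, 'm, 'c) module_scheme \<Rightarrow> 'm set \<Rightarrow> ('g \<Rightarrow> 'm \<Rightarrow> 'm) \<Rightarrow> 'g \<Rightarrow> 'm set \<Rightarrow> 'm set" where
  "quot_act M K act g = coset_map M K (act g)"

definition module_sum :: "('r, 'm, 'c) module_scheme \<Rightarrow> ('r, 'n, 'd) module_scheme \<Rightarrow> ('r, 'm \<times> 'n) module" where
  "module_sum M N =
    ring.extend (RDirProd M N) (module.fields (\<lambda>a (x, y). (a \<odot>\<^bsub>M\<^esub> x, a \<odot>\<^bsub>N\<^esub> y)))"

definition module_iso ::
  "('r, 'a) ring_scheme \<Rightarrow> ('r, 'm, 'c) module_scheme \<Rightarrow> ('r, 'n, 'd) module_scheme \<Rightarrow> ('m \<Rightarrow> 'n) set" where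
  "module_iso R M N =
    {h \<in> iso (add_monoid M) (add_monoid N).
      \<forall>a\<in>carrier R. \<forall>x\<in>carrier M. h (a \<odot>\<^bsub>M\<^esub> x) = a \<odot>\<^bsub>N\<^esub> h x}"

text \<open>\<open>multiples M k N\<close> is kN for a natural number k.\<close>

definition multiples :: "('r, 'm, 'c) module_scheme \<Rightarrow> nat \<Rightarrow> 'm set \<Rightarrow> 'm set" where
  "multiples M k N = {add_pow M k x | x. x \<in> N}"

text \<open>
  Group cohomology by the standard complex of inhomogeneous cochains. An n-cochain is a function
  from the n-fold power of G, here the lists of length n over G, to M; being extensional, it is
  determined by its values on these lists.
\<close>

definition tuples :: "('g, 'b) monoid_scheme \<Rightarrow> nat \<Rightarrow> 'g list set" where
  "tuples G n = {gs. set gs \<subseteq> carrier G \<and> length gs = n}"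

definition cochains ::
  "('g, 'b) monoid_scheme \<Rightarrow> ('r, 'm, 'c) module_scheme \<Rightarrow> nat \<Rightarrow> ('r, 'g list \<Rightarrow> 'm) module" where
  "cochains G M n =
    \<lparr>carrier = tuples G n \<rightarrow>\<^sub>E carrier M, monoid.mult = undefined, one = undefined,
     zero = (\<lambda>gs\<in>tuples G n. \<zero>\<^bsub>M\<^esub>),
     add = (\<lambda>f f'. \<lambda>gs\<in>tuples G n. f gs \<oplus>\<^bsub>M\<^esub> f' gs),
     smult = (\<lambda>a f. \<lambda>gs\<in>tuples G n. a \<odot>\<^bsub>M\<^esub> f gs)\<rparr>"

text \<open>
  \<open>merge G i [g\<^sub>1, \<dots>, g\<^sub>n]\<close> is \<open>[g\<^sub>1, \<dots>, g\<^sub>i g\<^sub>i\<^sub>+\<^sub>1, \<dots>, g\<^sub>n]\<close> for \<open>1 \<le> i < n\<close> (list positions count from 0).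
\<close>

definition merge :: "('g, 'b) monoid_scheme \<Rightarrow> nat \<Rightarrow> 'g list \<Rightarrow> 'g list" where
  "merge G i gs = take (i - 1) gs @ (gs ! (i - 1) \<otimes>\<^bsub>G\<^esub> gs ! i) # drop (i + 1) gs"

definition coboundary ::
  "('g, 'b) monoid_scheme \<Rightarrow> ('r, 'm, 'c) module_scheme \<Rightarrow> ('g \<Rightarrow> 'm \<Rightarrow> 'm) \<Rightarrow> nat
    \<Rightarrow> ('g list \<Rightarrow> 'm) \<Rightarrow> 'g list \<Rightarrow> 'm" where
  "coboundary G M act n f =
    (\<lambda>gs\<in>tuples G (n + 1).
       act (hd gs) (f (tl gs))
       \<oplus>\<^bsub>M\<^esub> (\<Oplus>\<^bsub>M\<^esub>i\<in>{1..n}. add_pow M ((-1::int) ^ i) (f (merge G i gs)))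
       \<oplus>\<^bsub>M\<^esub> add_pow M ((-1::int) ^ (n + 1)) (f (butlast gs)))"

definition cocycles ::
  "('g, 'b) monoid_scheme \<Rightarrow> ('r, 'm, 'c) module_scheme \<Rightarrow> ('g \<Rightarrow> 'm \<Rightarrow> 'm) \<Rightarrow> nat \<Rightarrow> ('g list \<Rightarrow> 'm) set" where
  "cocycles G M act n =
    {f \<in> carrier (cochains G M n). coboundary G M act n f = \<zero>\<^bsub>cochains G M (n + 1)\<^esub>}"

fun coboundaries ::
  "('g, 'b) monoid_scheme \<Rightarrow> ('r, 'm, 'c) module_scheme \<Rightarrow> ('g \<Rightarrow> 'm \<Rightarrow> 'm) \<Rightarrow> nat \<Rightarrow> ('g list \<Rightarrow> 'm) set" where
  "coboundaries G M act 0 = {\<zero>\<^bsub>cochains G M 0\<^esub>}"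
| "coboundaries G M act (Suc n) = coboundary G M act n ` carrier (cochains G M n)"

definition cohomology ::
  "nat \<Rightarrow> ('g, 'b) monoid_scheme \<Rightarrow> ('r, 'm, 'c) module_scheme \<Rightarrow> ('g \<Rightarrow> 'm \<Rightarrow> 'm)
    \<Rightarrow> ('r, ('g list \<Rightarrow> 'm) set) module" where
  "cohomology n G M act =
    quot_module ((cochains G M n)\<lparr>carrier := cocycles G M act n\<rparr>) (coboundaries G M act n)"

text \<open>The restriction map to the subgroup H, induced by restricting cocycles to tuples over H.\<close>

definition cohom_res ::
  "nat \<Rightarrow> ('g, 'b) monoid_scheme \<Rightarrow> ('r, 'm, 'c) module_scheme \<Rightarrow> ('g \<Rightarrow> 'm \<Rightarrow> 'm)
    \<Rightarrow> ('g list \<Rightarrow> 'm) set \<Rightarrow> ('g list \<Rightarrow> 'm) set" where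
  "cohom_res n H M act =
    coset_map ((cochains H M n)\<lparr>carrier := cocycles H M act n\<rparr>) (coboundaries H M act n)
      (\<lambda>f. restrict f (tuples H n))"

end

theory Submission
  imports Defs
begin

text \<open>
  Put \<open>q = p\<^sup>m\<close> and \<open>p\<^sup>r = u q\<^sup>2\<close>. For every subgroup \<open>H\<close>, the positive degree cohomology of \<open>H\<close>
  is annihilated by \<open>|H|\<close> and so by \<open>q\<close>. Hence for a cocycle \<open>c \<in> Z\<^sup>n\<^sup>+\<^sup>1(H, N)\<close> there is
  \<open>b \<in> C\<^sup>n(H, N)\<close> with \<open>d b = q c\<close>, and \<open>u q b\<close> is a cocycle modulo \<open>p\<^sup>r N\<close> because
  \<open>d (u q b) = p\<^sup>r c\<close>. Its class does not depend on \<open>b\<close>, since another choice changes \<open>q b\<close>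
  by \<open>q\<close> times a cocycle with values in \<open>N\<close>, which is a coboundary. This splits the connecting
  homomorphism \<open>H\<^sup>n(H, M/p\<^sup>rN) \<rightarrow> H\<^sup>n\<^sup>+\<^sup>1(H, N)\<close>, whose kernel is \<open>H\<^sup>n(H, M)\<close> because
  \<open>p\<^sup>r : N \<rightarrow> M\<close> induces zero in degree \<open>n\<close>. So the pairs
  of \<open>[z + u q b]\<close> and \<open>([z], [c])\<close>, with \<open>z \<in> Z\<^sup>n(H, M)\<close> and \<open>d b = q c\<close>, form the graph of
  the required isomorphism; as the graph involves no choices, it is compatible with restriction.
\<close>

section \<open>Modules, quotients and sums\<close>

text \<open>One factor q turns c into a coboundary and the other absorbs the ambiguity of its
  primitive; this is the origin of the bound 2m, and u only collects what is left of p^r. Since N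
  has no p-torsion, p^r maps N isomorphically onto p^r N, so 0 -> N -> M -> M/p^r N -> 0 is exact
  with p^r as its first map. This is why N itself, and not p^r N, appears in degree n+1, and why a
  lift g of a cocycle determines c through d g = p^r c. Degree n = 0 is excluded because q need not
  annihilate H^0(H, N), so p^r need not induce zero there. The obstacle is naturality: an
  isomorphism built for each H from its own choices, or from its own annihilator |H|, need not
  commute with restriction. Hence the same u and q serve every subgroup, and each isomorphism is
  recovered from a relation that admits all primitives b. The algebra uses nothing about groups
  beyond annihilation by q, so it is carried out for abstract complexes.\<close>

definition module_hom ::
  "('r, 'a) ring_scheme \<Rightarrow> ('r, 'm, 'c) module_scheme \<Rightarrow> ('r, 'n, 'd) module_scheme \<Rightarrow> ('m \<Rightarrow> 'n) set" where
  "module_hom R M N =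
    {h \<in> carrier M \<rightarrow> carrier N.
      (\<forall>x\<in>carrier M. \<forall>y\<in>carrier M. h (x \<oplus>\<^bsub>M\<^esub> y) = h x \<oplus>\<^bsub>N\<^esub> h y) \<and>
      (\<forall>a\<in>carrier R. \<forall>x\<in>carrier M. h (a \<odot>\<^bsub>M\<^esub> x) = a \<odot>\<^bsub>N\<^esub> h x)}"

lemma module_homI:
  assumes "\<And>x. x \<in> carrier M \<Longrightarrow> h x \<in> carrier N"
    and "\<And>x y. x \<in> carrier M \<Longrightarrow> y \<in> carrier M \<Longrightarrow> h (x \<oplus>\<^bsub>M\<^esub> y) = h x \<oplus>\<^bsub>N\<^esub> h y"
    and "\<And>a x. a \<in> carrier R \<Longrightarrow> x \<in> carrier M \<Longrightarrow> h (a \<odot>\<^bsub>M\<^esub> x) = a \<odot>\<^bsub>N\<^esub> h x"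
  shows "h \<in> module_hom R M N"
  using assms by (simp add: module_hom_def)

lemma module_hom_closed: "h \<in> module_hom R M N \<Longrightarrow> x \<in> carrier M \<Longrightarrow> h x \<in> carrier N"
  by (auto simp: module_hom_def)

lemma module_hom_add:
  "h \<in> module_hom R M N \<Longrightarrow> x \<in> carrier M \<Longrightarrow> y \<in> carrier M \<Longrightarrow> h (x \<oplus>\<^bsub>M\<^esub> y) = h x \<oplus>\<^bsub>N\<^esub> h y"
  by (auto simp: module_hom_def)

lemma module_hom_smult:
  "h \<in> module_hom R M N \<Longrightarrow> a \<in> carrier R \<Longrightarrow> x \<in> carrier M \<Longrightarrow> h (a \<odot>\<^bsub>M\<^esub> x) = a \<odot>\<^bsub>N\<^esub> h x"
  by (auto simp: module_hom_def)

lemma module_abelian_group: "module R M \<Longrightarrow> abelian_group M"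
  by (rule module.axioms)

lemma module_hom_abelian_group_hom:
  assumes "module R M" "module R N" "h \<in> module_hom R M N"
  shows "abelian_group_hom M N h"
  using assms
  by (intro abelian_group_hom.intro abelian_group_hom_axioms.intro group_hom.intro
        group_hom_axioms.intro module_abelian_group abelian_group.a_group)
    (auto simp: module_hom_def hom_def)

lemma module_hom_zero:
  assumes "module R M" "module R N" "h \<in> module_hom R M N"
  shows "h \<zero>\<^bsub>M\<^esub> = \<zero>\<^bsub>N\<^esub>"
  using abelian_group_hom.hom_zero[OF module_hom_abelian_group_hom[OF assms]] .

lemma module_hom_minus:
  assumes "module R M" "module R N" "h \<in> module_hom R M N" "x \<in> carrier M" "y \<in> carrier M"
  shows "h (x \<ominus>\<^bsub>M\<^esub> y) = h x \<ominus>\<^bsub>N\<^esub> h y"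
proof -
  interpret abelian_group_hom M N h
    using module_hom_abelian_group_hom assms by blast
  show ?thesis
    using assms by (simp add: a_minus_def)
qed

lemma (in abelian_group) minus_self: "x \<in> carrier G \<Longrightarrow> x \<ominus> x = \<zero>"
  by (simp add: a_minus_def r_neg)

lemma (in abelian_group) minus_zero: "x \<in> carrier G \<Longrightarrow> x \<ominus> \<zero> = x"
  using minus_equality[of \<zero> \<zero>] by (simp add: a_minus_def)

lemma (in abelian_group) eq_minusI:
  "x \<oplus> y = w \<Longrightarrow> x \<in> carrier G \<Longrightarrow> y \<in> carrier G \<Longrightarrow> x = w \<ominus> y"
  by (auto simp: a_minus_def a_assoc r_neg)

lemma (in abelian_group) minus_eq_zeroD:
  "x \<ominus> y = \<zero> \<Longrightarrow> x \<in> carrier G \<Longrightarrow> y \<in> carrier G \<Longrightarrow> x = y"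
  using add.inv_solve_right[of \<zero> x y] by (simp add: a_minus_def)

lemma (in abelian_group_hom) hom_add_pow_int:
  "x \<in> carrier G \<Longrightarrow> h (add_pow G (k::int) x) = add_pow H k (h x)"
  using group_hom.hom_int_pow[OF a_group_hom, of x k] by (simp add: add_pow_def)

lemma (in abelian_group_hom) hom_add_pow_nat:
  "x \<in> carrier G \<Longrightarrow> h (add_pow G (k::nat) x) = add_pow H k (h x)"
  using group_hom.hom_nat_pow[OF a_group_hom, of x k] by (simp add: add_pow_def)

lemma (in abelian_group_hom) hom_finsum:
  assumes "f \<in> A \<rightarrow> carrier G"
  shows "h (\<Oplus>\<^bsub>G\<^esub>i\<in>A. f i) = (\<Oplus>\<^bsub>H\<^esub>i\<in>A. h (f i))"
  using assms
proof (induction A rule: infinite_finite_induct)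
  case (insert i A)
  then show ?case by (simp add: Pi_def)
qed (simp_all add: hom_zero)

lemma module_hom_add_pow:
  assumes "module R M" "module R N" "h \<in> module_hom R M N" "x \<in> carrier M"
  shows "h (add_pow M (k::nat) x) = add_pow N k (h x)"
  using abelian_group_hom.hom_add_pow_nat[OF module_hom_abelian_group_hom[OF assms(1-3)] assms(4)] .

section \<open>Submodules, cosets and quotient modules\<close>

context module
begin

lemma add_pow_hom: "add_pow M (k::nat) \<in> module_hom R M M"
proof (rule module_homI)
  fix a x assume a: "a \<in> carrier R" and x: "x \<in> carrier M"
  have "(\<odot>\<^bsub>M\<^esub>) a \<in> hom (add_monoid M) (add_monoid M)"
    using a by (auto simp: hom_def smult_r_distr)
  then interpret h: abelian_group_hom M M "(\<odot>\<^bsub>M\<^esub>) a"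
    by unfold_locales (auto simp: abelian_group_hom_axioms_def)
  show "add_pow M k (a \<odot>\<^bsub>M\<^esub> x) = a \<odot>\<^bsub>M\<^esub> add_pow M k x"
    using h.hom_add_pow_nat x by simp
qed (simp_all add: M.add.nat_pow_distrib)

lemma submodule_abelian_subgroup: "submodule K R M \<Longrightarrow> abelian_subgroup K M"
  by (intro abelian_subgroupI3 additive_subgroupI submodule.axioms(1) M.abelian_group_axioms)

lemma submodule_zero: "submodule K R M \<Longrightarrow> \<zero>\<^bsub>M\<^esub> \<in> K"
  using additive_subgroup.zero_closed abelian_subgroup.axioms(1) submodule_abelian_subgroup by blast

lemma submodule_minus: "submodule K R M \<Longrightarrow> x \<in> K \<Longrightarrow> y \<in> K \<Longrightarrow> x \<ominus>\<^bsub>M\<^esub> y \<in> K"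
  unfolding a_minus_def using submoduleE(3,5) by blast

lemma submodule_add_pow: "submodule K R M \<Longrightarrow> x \<in> K \<Longrightarrow> add_pow M (k::nat) x \<in> K"
  by (induction k) (simp_all add: submodule_zero submoduleE(5))

lemma mem_submodule: "submodule K R M \<Longrightarrow> x \<in> K \<Longrightarrow> x \<in> carrier M"
  using submoduleE(1) by blast

lemma coset_eq_iff:
  assumes "submodule K R M" "x \<in> carrier M" "y \<in> carrier M"
  shows "K +>\<^bsub>M\<^esub> x = K +>\<^bsub>M\<^esub> y \<longleftrightarrow> x \<ominus>\<^bsub>M\<^esub> y \<in> K"
proof -
  interpret K: abelian_subgroup K M using assms(1) by (rule submodule_abelian_subgroup)
  have xy: "x \<ominus>\<^bsub>M\<^esub> y \<in> carrier M" using assms by simp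
  have "K +>\<^bsub>M\<^esub> x = K +>\<^bsub>M\<^esub> y \<longleftrightarrow> K +>\<^bsub>M\<^esub> (x \<ominus>\<^bsub>M\<^esub> y) = K"
    unfolding a_minus_def
    using M.a_coset_add_inv1[OF _ assms(2,3) K.a_subset] M.a_coset_add_inv2[OF _ assms(2,3) K.a_subset]
    by blast
  also have "\<dots> \<longleftrightarrow> x \<ominus>\<^bsub>M\<^esub> y \<in> K"
    using M.a_coset_join1[OF _ xy K.a_subgroup] M.a_coset_join2[OF xy K.a_subgroup] by blast
  finally show ?thesis .
qed

lemma coset_eq_self_iff:
  assumes "submodule K R M" "x \<in> carrier M"
  shows "K +>\<^bsub>M\<^esub> x = K \<longleftrightarrow> x \<in> K"
  using coset_eq_iff[OF assms M.zero_closed] M.a_coset_add_zero[OF submoduleE(1)[OF assms(1)]] assms(2)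
  by (simp add: M.minus_zero)

end

text \<open>Representatives of one coset differ by an element of \<open>K\<close>, which
  \<open>f\<close> sends into \<open>L\<close>. Scalar multiplication on quotients, the quotient
  action and restriction of classes are all evaluated on a representative through this fact.\<close>

lemma coset_map_coset:
  assumes M: "module R M" "submodule K R M" and N: "module R N" "submodule L R N"
    and f: "f \<in> module_hom R M N" "f ` K \<subseteq> L" and x: "x \<in> carrier M"
  shows "coset_map N L f (K +>\<^bsub>M\<^esub> x) = L +>\<^bsub>N\<^esub> f x"
proof -
  interpret M: module R M by fact
  interpret N: module R N by fact
  have "L +>\<^bsub>N\<^esub> f y = L +>\<^bsub>N\<^esub> f x" if yx: "y \<in> K +>\<^bsub>M\<^esub> x" for y
  proof -
    obtain k where k: "k \<in> K" "y = k \<oplus>\<^bsub>M\<^esub> x"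
      using yx by (auto simp: a_r_coset_def')
    have kM: "k \<in> carrier M" using M.mem_submodule M k by blast
    then have y: "y \<in> carrier M" using k x by simp
    have "f y \<ominus>\<^bsub>N\<^esub> f x = f (y \<ominus>\<^bsub>M\<^esub> x)"
      using module_hom_minus[OF M(1) N(1) f(1) y x] by simp
    also have "y \<ominus>\<^bsub>M\<^esub> x = k"
      using k kM x by (simp add: a_minus_def M.a_assoc M.r_neg)
    finally show ?thesis
      using N.coset_eq_iff[OF N(2)] f k module_hom_closed[OF f(1)] x y by auto
  qed
  moreover have "x \<in> K +>\<^bsub>M\<^esub> x"
    using abelian_subgroup.a_rcos_self[OF M.submodule_abelian_subgroup] M x by blast
  ultimately show ?thesis unfolding coset_map_def by blast
qed

lemma quot_module_simps [simp]:
  "add (quot_module M K) = set_add M"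
  "zero (quot_module M K) = K"
  by (simp_all add: quot_module_def)

lemma carrier_quot_module: "carrier (quot_module M K) = (\<lambda>x. K +>\<^bsub>M\<^esub> x) ` carrier M"
  by (auto simp: quot_module_def A_RCOSETS_def')

context module
begin

lemma quot_add:
  assumes "submodule K R M" "x \<in> carrier M" "y \<in> carrier M"
  shows "(K +>\<^bsub>M\<^esub> x) \<oplus>\<^bsub>quot_module M K\<^esub> (K +>\<^bsub>M\<^esub> y) = K +>\<^bsub>M\<^esub> (x \<oplus>\<^bsub>M\<^esub> y)"
  using abelian_subgroup.a_rcos_sum[OF submodule_abelian_subgroup] assms by simp

lemma smult_hom: "a \<in> carrier R \<Longrightarrow> (\<odot>\<^bsub>M\<^esub>) a \<in> module_hom R M M"
  by (intro module_homI) (simp_all add: smult_r_distr R.m_comm flip: smult_assoc1)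

lemma quot_smult:
  assumes "submodule K R M" "a \<in> carrier R" "x \<in> carrier M"
  shows "a \<odot>\<^bsub>quot_module M K\<^esub> (K +>\<^bsub>M\<^esub> x) = K +>\<^bsub>M\<^esub> (a \<odot>\<^bsub>M\<^esub> x)"
proof -
  have "(\<odot>\<^bsub>M\<^esub>) a ` K \<subseteq> K"
    using submoduleE(4)[OF assms(1)] assms(2) by blast
  then show ?thesis
    using coset_map_coset[OF module_axioms assms(1) module_axioms assms(1) smult_hom] assms
    by (simp add: quot_module_def)
qed

lemma quot_module_module:
  assumes K: "submodule K R M"
  shows "module R (quot_module M K)"
proof -
  interpret K: abelian_subgroup K M using K by (rule submodule_abelian_subgroup)
  have "group (M A_Mod K)" by (rule K.a_factorgroup_is_group)
  have K0: "K = K +>\<^bsub>M\<^esub> \<zero>\<^bsub>M\<^esub>" using K.a_subset by simp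
  note simps = quot_add[OF K] quot_smult[OF K] carrier_quot_module
  show ?thesis
  proof (rule moduleI)
    show "abelian_group (quot_module M K)"
    proof (rule abelian_groupI)
      fix x assume "x \<in> carrier (quot_module M K)"
      then obtain x' where x: "x' \<in> carrier M" "x = K +>\<^bsub>M\<^esub> x'" by (auto simp: simps)
      show "\<zero>\<^bsub>quot_module M K\<^esub> \<oplus>\<^bsub>quot_module M K\<^esub> x = x"
        using quot_add[OF K M.zero_closed x(1)] x K0 by simp
      show "\<exists>y\<in>carrier (quot_module M K). y \<oplus>\<^bsub>quot_module M K\<^esub> x = \<zero>\<^bsub>quot_module M K\<^esub>"
        using x quot_add[OF K _ x(1), of "\<ominus>\<^bsub>M\<^esub> x'"] K0
        by (intro bexI[of _ "K +>\<^bsub>M\<^esub> (\<ominus>\<^bsub>M\<^esub> x')"]) (auto simp: simps M.l_neg simp del: quot_module_simps(1))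
    next
      show "\<zero>\<^bsub>quot_module M K\<^esub> \<in> carrier (quot_module M K)"
        using K0 by (auto simp: simps)
    qed (auto simp: simps M.a_ac simp del: quot_module_simps)
  qed (auto simp: simps smult_l_distr smult_r_distr smult_assoc1 R.is_cring simp del: quot_module_simps)
qed

lemma quot_hom: "submodule K R M \<Longrightarrow> (\<lambda>x. K +>\<^bsub>M\<^esub> x) \<in> module_hom R M (quot_module M K)"
  by (intro module_homI) (simp_all add: carrier_quot_module quot_add quot_smult del: quot_module_simps)

end

section \<open>Direct sums, and isomorphisms given by their graphs\<close>

lemma module_sum_simps [simp]:
  "carrier (module_sum M N) = carrier M \<times> carrier N"
  "x \<oplus>\<^bsub>module_sum M N\<^esub> y = (fst x \<oplus>\<^bsub>M\<^esub> fst y, snd x \<oplus>\<^bsub>N\<^esub> snd y)"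
  "\<zero>\<^bsub>module_sum M N\<^esub> = (\<zero>\<^bsub>M\<^esub>, \<zero>\<^bsub>N\<^esub>)"
  "a \<odot>\<^bsub>module_sum M N\<^esub> x = (a \<odot>\<^bsub>M\<^esub> fst x, a \<odot>\<^bsub>N\<^esub> snd x)"
  by (simp_all add: module_sum_def ring.defs module.defs RDirProd_def DirProd_def monoid.defs split_beta)

lemma module_sum_module:
  assumes "module R M" "module R N"
  shows "module R (module_sum M N)"
proof -
  interpret M: module R M by fact
  interpret N: module R N by fact
  have "\<exists>y\<in>carrier (module_sum M N). y \<oplus>\<^bsub>module_sum M N\<^esub> x = \<zero>\<^bsub>module_sum M N\<^esub>"
    if "x \<in> carrier (module_sum M N)" for x
    using that
    by (intro bexI[of _ "(\<ominus>\<^bsub>M\<^esub> fst x, \<ominus>\<^bsub>N\<^esub> snd x)"]) (auto simp: M.l_neg N.l_neg)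
  then have "abelian_group (module_sum M N)"
    by (intro abelian_groupI) (auto simp: M.a_ac N.a_ac)
  then show ?thesis
    by (intro moduleI)
      (auto simp: M.smult_l_distr N.smult_l_distr M.smult_r_distr N.smult_r_distr
        M.smult_assoc1 N.smult_assoc1 M.R.is_cring)
qed

text \<open>Differences of related pairs are related, so uniqueness in either direction need only be
  checked over zero. The conclusion keeps the relation, because naturality will be read off from
  it.\<close>

lemma module_iso_of_relation:
  assumes A: "module R A" and B: "module R B"
    and carr: "\<And>x y. \<rho> x y \<Longrightarrow> x \<in> carrier A \<and> y \<in> carrier B"
    and add: "\<And>x y x' y'. \<rho> x y \<Longrightarrow> \<rho> x' y' \<Longrightarrow> \<rho> (x \<oplus>\<^bsub>A\<^esub> x') (y \<oplus>\<^bsub>B\<^esub> y')"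
    and smult: "\<And>a x y. a \<in> carrier R \<Longrightarrow> \<rho> x y \<Longrightarrow> \<rho> (a \<odot>\<^bsub>A\<^esub> x) (a \<odot>\<^bsub>B\<^esub> y)"
    and left: "\<And>x. x \<in> carrier A \<Longrightarrow> \<exists>y. \<rho> x y"
    and right: "\<And>y. y \<in> carrier B \<Longrightarrow> \<exists>x. \<rho> x y"
    and zero: "\<And>y. \<rho> \<zero>\<^bsub>A\<^esub> y \<Longrightarrow> y = \<zero>\<^bsub>B\<^esub>" "\<And>x. \<rho> x \<zero>\<^bsub>B\<^esub> \<Longrightarrow> x = \<zero>\<^bsub>A\<^esub>"
  shows "\<exists>\<phi>\<in>module_iso R A B. \<forall>x y. \<rho> x y \<longrightarrow> \<phi> x = y"
proof -
  interpret A: module R A by fact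
  interpret B: module R B by fact
  \<comment> \<open>Negatives come from scalar multiplication by minus one, so no closure under
    inverses has to be assumed.\<close>
  have minus: "\<rho> (x \<ominus>\<^bsub>A\<^esub> x') (y \<ominus>\<^bsub>B\<^esub> y')" if "\<rho> x y" "\<rho> x' y'" for x x' y y'
  proof -
    have "\<rho> ((\<ominus>\<^bsub>R\<^esub> \<one>\<^bsub>R\<^esub>) \<odot>\<^bsub>A\<^esub> x') ((\<ominus>\<^bsub>R\<^esub> \<one>\<^bsub>R\<^esub>) \<odot>\<^bsub>B\<^esub> y')"
      using that by (intro smult) auto
    from add[OF that(1) this] show ?thesis
      using carr[OF that(2)] by (simp add: A.smult_l_minus B.smult_l_minus a_minus_def)
  qed
  have det1: "y = y'" if "\<rho> x y" "\<rho> x y'" for x y y'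
  proof -
    have "x \<ominus>\<^bsub>A\<^esub> x = \<zero>\<^bsub>A\<^esub>" using carr[OF that(1)] by (simp add: A.minus_self)
    then have "y \<ominus>\<^bsub>B\<^esub> y' = \<zero>\<^bsub>B\<^esub>" using minus[OF that] zero by metis
    then show ?thesis using carr that B.minus_eq_zeroD by blast
  qed
  have det2: "x = x'" if "\<rho> x y" "\<rho> x' y" for x x' y
  proof -
    have "y \<ominus>\<^bsub>B\<^esub> y = \<zero>\<^bsub>B\<^esub>" using carr[OF that(1)] by (simp add: B.minus_self)
    then have "x \<ominus>\<^bsub>A\<^esub> x' = \<zero>\<^bsub>A\<^esub>" using minus[OF that] zero by metis
    then show ?thesis using carr that A.minus_eq_zeroD by blast
  qed
  define \<phi> where "\<phi> x = (THE y. \<rho> x y)" for x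
  have \<phi>I: "\<phi> x = y" if "\<rho> x y" for x y
    unfolding \<phi>_def using that det1 by blast
  have \<phi>: "\<rho> x (\<phi> x)" if "x \<in> carrier A" for x
    using left[OF that] \<phi>I by blast
  have "bij_betw \<phi> (carrier A) (carrier B)"
    unfolding bij_betw_def
  proof
    show "inj_on \<phi> (carrier A)" by (intro inj_onI) (metis \<phi> det2)
    show "\<phi> ` carrier A = carrier B"
    proof
      show "\<phi> ` carrier A \<subseteq> carrier B" using \<phi> carr by blast
      show "carrier B \<subseteq> \<phi> ` carrier A"
        using right carr \<phi>I by (metis imageI subsetI)
    qed
  qed
  then have "\<phi> \<in> module_iso R A B"
    using \<phi> carr by (auto simp: module_iso_def iso_def hom_def intro!: \<phi>I add smult)
  then show ?thesis using \<phi>I by blast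
qed

section \<open>Kernels, images and subquotients\<close>

lemma module_hom_a_inv:
  assumes "module R M" "module R N" "h \<in> module_hom R M N" "x \<in> carrier M"
  shows "h (\<ominus>\<^bsub>M\<^esub> x) = \<ominus>\<^bsub>N\<^esub> h x"
  using abelian_group_hom.hom_a_inv[OF module_hom_abelian_group_hom[OF assms(1-3)] assms(4)] .

lemma kernel_submodule:
  assumes M: "module R M" and N: "module R N" and h: "h \<in> module_hom R M N"
  shows "submodule {x \<in> carrier M. h x = \<zero>\<^bsub>N\<^esub>} R M"
proof -
  interpret M: module R M by fact
  interpret N: module R N by fact
  have "h (\<ominus>\<^bsub>M\<^esub> x) = \<zero>\<^bsub>N\<^esub>" if "x \<in> carrier M" "h x = \<zero>\<^bsub>N\<^esub>" for x
    using module_hom_a_inv[OF M N h that(1)] that(2) N.minus_equality[of "\<zero>\<^bsub>N\<^esub>" "\<zero>\<^bsub>N\<^esub>"] by simp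
  then show ?thesis
    by (intro M.submoduleI)
      (auto simp: module_hom_zero[OF M N h] module_hom_add[OF h] module_hom_smult[OF h])
qed

lemma image_submodule:
  assumes M: "module R M" and N: "module R N" and h: "h \<in> module_hom R M N" and K: "submodule K R M"
  shows "submodule (h ` K) R N"
proof -
  interpret M: module R M by fact
  interpret N: module R N by fact
  note mem = M.mem_submodule[OF K]
  show ?thesis
  proof (rule N.submoduleI)
    show "h ` K \<subseteq> carrier N"
      using mem module_hom_closed[OF h] by blast
    show "\<zero>\<^bsub>N\<^esub> \<in> h ` K"
      using M.submodule_zero[OF K] module_hom_zero[OF M N h] by (metis imageI)
    show "\<ominus>\<^bsub>N\<^esub> y \<in> h ` K" if y: "y \<in> h ` K" for y
    proof -
      obtain x where "x \<in> K" "y = h x" using y by blast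
      then show ?thesis
        using M.submoduleE(3)[OF K, of x] module_hom_a_inv[OF M N h mem] by force
    qed
    show "y \<oplus>\<^bsub>N\<^esub> y' \<in> h ` K" if y: "y \<in> h ` K" "y' \<in> h ` K" for y y'
    proof -
      obtain x x' where "x \<in> K" "y = h x" "x' \<in> K" "y' = h x'" using y by blast
      then show ?thesis
        using M.submoduleE(5)[OF K, of x x'] module_hom_add[OF h, of x x'] mem by force
    qed
    show "a \<odot>\<^bsub>N\<^esub> y \<in> h ` K" if a: "a \<in> carrier R" and y: "y \<in> h ` K" for a y
    proof -
      obtain x where "x \<in> K" "y = h x" using y by blast
      then show ?thesis
        using M.submoduleE(4)[OF K a, of x] module_hom_smult[OF h a, of x] mem by force
    qed
  qed
qed

lemma submodule_restrict_carrier: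
  assumes M: "module R M" and K: "submodule K R M" and Z: "submodule Z R M" "K \<subseteq> Z"
  shows "submodule K R (M\<lparr>carrier := Z\<rparr>)"
  using module.module_incl_imp_submodule[OF submodule.submodule_is_module[OF Z(1) M], of K]
    submodule.submodule_is_module[OF K M] Z(2)
  by simp

text \<open>Cosets, their sums and \<open>coset_map\<close> never consult the carrier of the ambient
  module. Hence a subquotient such as cocycles modulo coboundaries can be computed in the quotient
  of all cochains.\<close>

lemma quot_module_restrict_carrier:
  "quot_module (M\<lparr>carrier := Z\<rparr>) K = (quot_module M K)\<lparr>carrier := (\<lambda>x. K +>\<^bsub>M\<^esub> x) ` Z\<rparr>"
  by (auto simp: quot_module_def A_RCOSETS_def' a_r_coset_def' set_add_def' coset_map_def fun_eq_iff)

lemma subquotient_module: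
  assumes "module R M" "submodule K R M" "submodule Z R M" "K \<subseteq> Z"
  shows "module R (quot_module (M\<lparr>carrier := Z\<rparr>) K)"
  using module.quot_module_module[OF submodule.submodule_is_module submodule_restrict_carrier] assms by blast

section \<open>The complex of inhomogeneous cochains\<close>

lemma cochains_simps [simp]:
  "carrier (cochains G M n) = tuples G n \<rightarrow>\<^sub>E carrier M"
  "\<zero>\<^bsub>cochains G M n\<^esub> = (\<lambda>gs\<in>tuples G n. \<zero>\<^bsub>M\<^esub>)"
  "f \<oplus>\<^bsub>cochains G M n\<^esub> f' = (\<lambda>gs\<in>tuples G n. f gs \<oplus>\<^bsub>M\<^esub> f' gs)"
  "a \<odot>\<^bsub>cochains G M n\<^esub> f = (\<lambda>gs\<in>tuples G n. a \<odot>\<^bsub>M\<^esub> f gs)"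
  by (simp_all add: cochains_def)

lemma cochain_apply: "f \<in> tuples G n \<rightarrow>\<^sub>E carrier M \<Longrightarrow> gs \<in> tuples G n \<Longrightarrow> f gs \<in> carrier M"
  by (rule PiE_mem)

lemma cochains_submodule: "cochains G (M\<lparr>carrier := N\<rparr>) n = (cochains G M n)\<lparr>carrier := tuples G n \<rightarrow>\<^sub>E N\<rparr>"
  by (simp add: cochains_def)

lemma cochains_module:
  assumes "module R M"
  shows "module R (cochains G M n)"
proof -
  interpret M: module R M by fact
  have ext: "f = f'" if "f \<in> tuples G n \<rightarrow>\<^sub>E carrier M" "f' \<in> tuples G n \<rightarrow>\<^sub>E carrier M"
    "\<And>gs. gs \<in> tuples G n \<Longrightarrow> f gs = f' gs" for f f'
    using that by (rule PiE_ext)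
  have "\<exists>f'\<in>carrier (cochains G M n). f' \<oplus>\<^bsub>cochains G M n\<^esub> f = \<zero>\<^bsub>cochains G M n\<^esub>"
    if "f \<in> carrier (cochains G M n)" for f
    using that
    by (intro bexI[of _ "\<lambda>gs\<in>tuples G n. \<ominus>\<^bsub>M\<^esub> f gs"]) (auto simp: M.l_neg cochain_apply intro!: restrict_ext)
  then have "abelian_group (cochains G M n)"
    by (intro abelian_groupI) (auto simp: M.a_ac cochain_apply intro!: ext)
  then show ?thesis
    by (intro moduleI)
      (auto simp: M.smult_l_distr M.smult_r_distr M.smult_assoc1 M.R.is_cring cochain_apply intro!: ext)
qed

text \<open>Multiples in the module of cochains are iterated sums of functions; that evaluation is a
  homomorphism shows them to be pointwise.\<close>

lemma cochains_eval_hom: "gs \<in> tuples G n \<Longrightarrow> (\<lambda>f. f gs) \<in> module_hom R (cochains G M n) M"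
  by (intro module_homI) auto

lemma cochains_add_pow_apply:
  assumes "module R M" "f \<in> carrier (cochains G M n)" "gs \<in> tuples G n"
  shows "add_pow (cochains G M n) (k::nat) f gs = add_pow M k (f gs)"
  by (rule module_hom_add_pow[OF cochains_module[OF assms(1)] assms(1) cochains_eval_hom[OF assms(3)] assms(2)])

lemma cochains_add_pow_int_apply:
  assumes "module R M" "f \<in> carrier (cochains G M n)" "gs \<in> tuples G n"
  shows "add_pow (cochains G M n) (k::int) f gs = add_pow M k (f gs)"
  by (rule abelian_group_hom.hom_add_pow_int[OF module_hom_abelian_group_hom[OF
        cochains_module[OF assms(1)] assms(1) cochains_eval_hom[OF assms(3)]] assms(2)])

section \<open>Tuples and the merging of neighbouring entries\<close>

lemma tuples_simps:
  assumes "gs \<in> tuples G (Suc n)"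
  shows "hd gs \<in> carrier G" "tl gs \<in> tuples G n" "butlast gs \<in> tuples G n" "last gs \<in> carrier G"
    "gs = butlast gs @ [last gs]"
  using assms by (cases gs; force simp: tuples_def dest: in_set_butlastD)+

lemma tuples_append: "gs \<in> tuples G n \<Longrightarrow> g \<in> carrier G \<Longrightarrow> gs @ [g] \<in> tuples G (Suc n)"
  by (auto simp: tuples_def)

lemma (in monoid) merge_tuples:
  assumes "gs \<in> tuples G (Suc n)" "1 \<le> i" "i \<le> n"
  shows "merge G i gs \<in> tuples G n"
proof -
  have "gs ! (i - 1) \<in> carrier G" "gs ! i \<in> carrier G"
    using assms by (auto simp: tuples_def intro!: subsetD[OF _ nth_mem])
  then show ?thesis
    using assms by (auto simp: tuples_def merge_def dest: in_set_takeD in_set_dropD)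
qed

lemma length_merge: "length gs = Suc n \<Longrightarrow> 1 \<le> i \<Longrightarrow> i \<le> n \<Longrightarrow> length (merge G i gs) = n"
  by (auto simp: merge_def)

lemma merge_nth:
  assumes "length gs = Suc n" "1 \<le> i" "i \<le> n" "k < n"
  shows "merge G i gs ! k =
    (if Suc k < i then gs ! k else if Suc k = i then gs ! k \<otimes>\<^bsub>G\<^esub> gs ! i else gs ! Suc k)"
proof -
  \<comment> \<open>The positions behind the product are written as \<open>i + d\<close>, which is
    position \<open>d\<close> of the dropped tail.\<close>
  consider "Suc k < i" | "Suc k = i" | d where "k = i + d"
    by (metis less_iff_Suc_add linorder_neqE_nat not_less_eq add_Suc_right add_Suc)
  then show ?thesis
    using assms by cases (auto simp: merge_def nth_append nth_Cons')
qed

text \<open>The simplicial identity for two inner faces, compared entry by entry. Associativity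
  matters only for \<open>j = i + 1\<close>, where three consecutive entries are multiplied.\<close>

lemma (in monoid) merge_merge:
  assumes gs: "gs \<in> tuples G (Suc (Suc n))" and ij: "1 \<le> i" "i < j" "j \<le> Suc n"
  shows "merge G i (merge G j gs) = merge G (j - 1) (merge G i gs)"
proof (rule nth_equalityI)
  have l: "length gs = Suc (Suc n)" using gs by (simp add: tuples_def)
  have lj: "length (merge G j gs) = Suc n" and li: "length (merge G i gs) = Suc n"
    using length_merge[OF l, of j G] length_merge[OF l, of i G] ij by auto
  show "length (merge G i (merge G j gs)) = length (merge G (j - 1) (merge G i gs))"
    using length_merge[OF lj, of i G] length_merge[OF li, of "j - 1" G] ij by fastforce
  fix k assume "k < length (merge G i (merge G j gs))"
  then have k: "k < n" using length_merge[OF lj, of i G] ij by simp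
  have mem: "gs ! l \<in> carrier G" if "l < Suc (Suc n)" for l
    using that gs by (auto simp: tuples_def)
  \<comment> \<open>This is the second factor in the outer merge at \<open>i\<close>. It is itself a
    product exactly when the two merges are adjacent; the first factor lies before the merge at
    \<open>j\<close>.\<close>
  have "merge G j gs ! i = (if Suc i < j then gs ! i else if Suc i = j then gs ! i \<otimes> gs ! j else gs ! Suc i)"
    using merge_nth[OF l, of j i G] ij by simp
  then show "merge G i (merge G j gs) ! k = merge G (j - 1) (merge G i gs) ! k"
    using merge_nth[OF lj, of i k G] merge_nth[OF li, of "j - 1" k G] merge_nth[OF l, of j k G]
      merge_nth[OF l, of j "Suc k" G] merge_nth[OF l, of i k G] merge_nth[OF l, of i "Suc k" G]
      merge_nth[OF l, of i "j - 1" G] ij k mem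
    by (auto simp: m_assoc)
qed

lemma merge_Cons: "2 \<le> i \<Longrightarrow> merge G i (g # gs) = g # merge G (i - 1) gs"
  by (auto simp: merge_def nth_Cons' take_Cons' drop_Cons')

lemma merge_append: "i < length gs \<Longrightarrow> 1 \<le> i \<Longrightarrow> merge G i (gs @ [g]) = merge G i gs @ [g]"
  by (auto simp: merge_def nth_append)

lemma merge_last: "merge G (Suc (length gs)) (gs @ [g, h]) = gs @ [g \<otimes>\<^bsub>G\<^esub> h]"
  by (simp add: merge_def nth_append)

text \<open>The unsigned terms of \<open>coboundary\<close>. Treating the two outer terms like the
  inner ones gives an alternating sum over one index range, to which the simplicial identities
  apply. Here \<open>n\<close> is the degree of \<open>f\<close>, and every index above
  \<open>n\<close> counts as the last face.\<close>

definition face ::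
  "('g, 'b) monoid_scheme \<Rightarrow> ('g \<Rightarrow> 'm \<Rightarrow> 'm) \<Rightarrow> nat \<Rightarrow> nat \<Rightarrow> ('g list \<Rightarrow> 'm) \<Rightarrow> 'g list \<Rightarrow> 'm" where
  "face G act n i f gs =
    (if i = 0 then act (hd gs) (f (tl gs)) else if i \<le> n then f (merge G i gs) else f (butlast gs))"

lemma (in abelian_group) add_pow_int_group_hom: "abelian_group_hom G G (add_pow G (k::int))"
  by (intro abelian_group_hom.intro abelian_group_hom_axioms.intro group_hom.intro
      group_hom_axioms.intro a_group abelian_group_axioms)
    (simp add: hom_def add.int_pow_distrib)

lemma (in abelian_group) finsum_swap_atMost:
  assumes "\<And>i j. j \<in> A \<Longrightarrow> f i j \<in> carrier G"
  shows "(\<Oplus>j\<in>A. \<Oplus>i\<in>{..n::nat}. f i j) = (\<Oplus>i\<in>{..n}. \<Oplus>j\<in>A. f i j)"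
proof (induction n)
  case 0
  have "(\<Oplus>j\<in>A. \<Oplus>i\<in>{..0::nat}. f i j) = (\<Oplus>j\<in>A. f 0 j)"
    using assms by (intro finsum_cong') auto
  then show ?case using assms by simp
next
  case (Suc n)
  have "(\<Oplus>j\<in>A. \<Oplus>i\<in>{..Suc n}. f i j) = (\<Oplus>j\<in>A. f (Suc n) j \<oplus> (\<Oplus>i\<in>{..n}. f i j))"
    using assms by (intro finsum_cong') (auto intro!: finsum_closed)
  also have "\<dots> = (\<Oplus>j\<in>A. f (Suc n) j) \<oplus> (\<Oplus>j\<in>A. \<Oplus>i\<in>{..n}. f i j)"
    using assms by (intro finsum_addf) (auto intro!: finsum_closed)
  finally show ?case
    using Suc assms by (simp add: Pi_def)
qed

text \<open>The combinatorial core of d d = 0, freed from cochains. Passing from \<open>n\<close> to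
  \<open>n + 1\<close> adds one row and one column to the array, and these cancel each
  other.\<close>

lemma (in abelian_group) alternating_double_sum:
  assumes D: "\<And>i j. D j i \<in> carrier G"
    and swap: "\<And>i j. i < j \<Longrightarrow> j \<le> Suc n \<Longrightarrow> D j i = D i (j - 1)"
  shows "(\<Oplus>j\<in>{..Suc n}. \<Oplus>i\<in>{..n}. add_pow G ((-1::int) ^ (i + j)) (D j i)) = \<zero>"
  using swap
proof (induction n)
  case 0
  then have "D (Suc 0) 0 = D 0 0" by simp
  then show ?case
    using D add.int_pow_neg[of "D 0 0" 1] by (simp add: l_neg)
next
  case (Suc n)
  define t where "t j i = add_pow G ((-1::int) ^ (i + j)) (D j i)" for j i
  have t: "t j i \<in> carrier G" for j i
    unfolding t_def using D by simp
  have IH: "(\<Oplus>j\<in>{..Suc n}. \<Oplus>i\<in>{..n}. t j i) = \<zero>"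
    unfolding t_def using Suc by simp
  \<comment> \<open>The new row against the new column: \<open>swap\<close> identifies the two
    entries, and their sign exponents \<open>i + n + 2\<close> and \<open>i + n + 1\<close> have
    opposite parity.\<close>
  have cancel: "t (Suc (Suc n)) i \<oplus> t i (Suc n) = \<zero>" if "i \<in> {..Suc n}" for i
  proof -
    have "D (Suc (Suc n)) i = D i (Suc n)" using Suc.prems[of i "Suc (Suc n)"] that by simp
    then show ?thesis
      using D add.int_pow_neg[of "D i (Suc n)" "(-1) ^ (i + n)"]
      by (simp add: t_def l_neg r_neg add.commute)
  qed
  have row: "(\<Oplus>i\<in>{..Suc n}. t j i) = t j (Suc n) \<oplus> (\<Oplus>i\<in>{..n}. t j i)" for j
    using t by (intro finsum_Suc) auto
  have "(\<Oplus>j\<in>{..Suc (Suc n)}. \<Oplus>i\<in>{..Suc n}. t j i)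
      = (\<Oplus>i\<in>{..Suc n}. t (Suc (Suc n)) i) \<oplus> (\<Oplus>j\<in>{..Suc n}. \<Oplus>i\<in>{..Suc n}. t j i)"
    using t by (intro finsum_Suc) (auto intro!: finsum_closed)
  also have "\<dots>
      = (\<Oplus>i\<in>{..Suc n}. t (Suc (Suc n)) i) \<oplus> (\<Oplus>j\<in>{..Suc n}. t j (Suc n) \<oplus> (\<Oplus>i\<in>{..n}. t j i))"
    unfolding row ..
  also have "\<dots> = (\<Oplus>i\<in>{..Suc n}. t (Suc (Suc n)) i) \<oplus> (\<Oplus>j\<in>{..Suc n}. t j (Suc n))"
    using t IH by (simp add: Pi_def finsum_addf del: finsum_Suc)
  also have "\<dots> = (\<Oplus>i\<in>{..Suc n}. t (Suc (Suc n)) i \<oplus> t i (Suc n))"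
    using t by (simp add: Pi_def finsum_addf del: finsum_Suc)
  also have "\<dots> = \<zero>"
    using cancel by (subst finsum_cong'[of _ _ "\<lambda>_. \<zero>"]) auto
  finally show ?case unfolding t_def .
qed

context rg_module
begin

lemma act_hom: "g \<in> carrier G \<Longrightarrow> act g \<in> module_hom R M M"
  by (intro module_homI act_closed act_add act_smult)

lemma face_closed:
  assumes "f \<in> carrier (cochains G M n)" "gs \<in> tuples G (Suc n)"
  shows "face G act n i f gs \<in> carrier M"
  using assms tuples_simps[OF assms(2)] merge_tuples[OF assms(2)]
  by (auto simp: face_def cochain_apply intro!: act_closed)

lemma coboundary_eq:
  assumes "f \<in> carrier (cochains G M n)" "gs \<in> tuples G (Suc n)"
  shows "coboundary G M act n f gs = (\<Oplus>\<^bsub>M\<^esub>i\<in>{..Suc n}. add_pow M ((-1::int) ^ i) (face G act n i f gs))"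
proof -
  define t where "t i = add_pow M ((-1::int) ^ i) (face G act n i f gs)" for i
  have t: "t i \<in> carrier M" for i using face_closed[OF assms] by (simp add: t_def)
  have "{..n} = insert 0 {1..n}" by auto
  then have "(\<Oplus>\<^bsub>M\<^esub>i\<in>{..Suc n}. t i) = t (Suc n) \<oplus>\<^bsub>M\<^esub> (t 0 \<oplus>\<^bsub>M\<^esub> (\<Oplus>\<^bsub>M\<^esub>i\<in>{1..n}. t i))"
    using t by (simp add: Pi_def)
  also have "\<dots> = t 0 \<oplus>\<^bsub>M\<^esub> (\<Oplus>\<^bsub>M\<^esub>i\<in>{1..n}. t i) \<oplus>\<^bsub>M\<^esub> t (Suc n)"
    using t by (intro M.a_comm) (auto simp: Pi_def)
  also have "(\<Oplus>\<^bsub>M\<^esub>i\<in>{1..n}. t i) = (\<Oplus>\<^bsub>M\<^esub>i\<in>{1..n}. add_pow M ((-1::int) ^ i) (f (merge G i gs)))"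
    using face_closed[OF assms] by (intro M.finsum_cong') (auto simp: t_def face_def, metis (full_types) face_def le_zero_eq not_less_eq_eq M.add.int_pow_closed)
  also have "t 0 = act (hd gs) (f (tl gs))"
    using face_closed[OF assms, of 0] by (simp add: t_def face_def)
  also have "t (Suc n) = add_pow M ((-1::int) ^ (n + 1)) (f (butlast gs))"
    by (simp add: t_def face_def)
  finally show ?thesis
    using assms(2) by (simp add: coboundary_def t_def)
qed

lemma coboundary_closed:
  assumes "f \<in> carrier (cochains G M n)"
  shows "coboundary G M act n f \<in> carrier (cochains G M (Suc n))"
proof -
  have "coboundary G M act n f gs \<in> carrier M" if "gs \<in> tuples G (Suc n)" for gs
    using coboundary_eq[OF assms that] face_closed[OF assms that] by (simp add: Pi_def)
  then show ?thesis by (auto simp: coboundary_def)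
qed

text \<open>The simplicial identities, split by whether each index is the first, an inner or the
  last face. Multiplicativity of the action is needed only for \<open>i = 0\<close>,
  \<open>j = 1\<close>, and associativity only for two inner faces; the other cases are list
  manipulation.\<close>

lemma face_face:
  assumes f: "f \<in> carrier (cochains G M n)" and gs: "gs \<in> tuples G (Suc (Suc n))"
    and ij: "i < j" "j \<le> Suc (Suc n)"
  shows "face G act (Suc n) j (face G act n i f) gs = face G act (Suc n) i (face G act n (j - 1) f) gs"
proof -
  obtain g h hs where gs': "gs = g # h # hs" "length hs = n"
    using gs by (auto simp: tuples_def length_Suc_conv)
  have G: "g \<in> carrier G" "h \<in> carrier G" "hs \<in> tuples G n"
    using gs by (auto simp: tuples_def gs')
  consider "i = 0" "j = 1" | "i = 0" "2 \<le> j" "j \<le> Suc n" | "i = 0" "j = Suc (Suc n)"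
    | "1 \<le> i" "j \<le> Suc n" | "1 \<le> i" "i \<le> n" "j = Suc (Suc n)" | "i = Suc n" "j = Suc (Suc n)"
    using ij by linarith
  then show ?thesis
  proof cases
    case 1
    then show ?thesis
      using G f by (simp add: face_def gs' merge_def act_mult cochain_apply)
  next
    case 2
    then have "j - 1 \<le> n" by arith
    with 2 show ?thesis
      by (simp add: face_def gs' merge_Cons)
  next
    case 3
    then show ?thesis by (simp add: face_def gs')
  next
    case 4
    then have "j - 1 \<le> n" by arith
    with 4 show ?thesis using merge_merge[OF gs, of i j] ij by (simp add: face_def)
  next
    case 5
    then have "merge G i gs = merge G i (butlast gs) @ [last gs]"
      using merge_append[of i "butlast gs" G "last gs"] gs' tuples_simps(5)[OF gs] by (metis butlast.simps(2) length_Cons length_butlast diff_Suc_1 le_imp_less_Suc list.distinct(1))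
    then show ?thesis using 5 by (simp add: face_def)
  next
    case 6
    obtain ks a b where ks: "gs = ks @ [a, b]"
      using tuples_simps(5)[OF gs] tuples_simps(5)[OF tuples_simps(3)[OF gs]]
      by (metis append.assoc append_Cons append_Nil)
    moreover have "length ks = n" using gs ks by (simp add: tuples_def)
    ultimately show ?thesis
      using 6 merge_last[of G ks a b] by (simp add: face_def butlast_append)
  qed
qed

text \<open>Needed because d d takes faces of a signed sum of faces. A face evaluates its cochain
  only at tuples, so \<open>f'\<close> has to be known only there and need not be
  extensional.\<close>

lemma face_additive:
  assumes "gs \<in> tuples G (Suc n)" "finite A" "\<And>k. k \<in> A \<Longrightarrow> f k \<in> carrier (cochains G M n)"
    and "\<And>gs. gs \<in> tuples G n \<Longrightarrow> f' gs = (\<Oplus>\<^bsub>M\<^esub>k\<in>A. add_pow M (s k :: int) (f k gs))"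
  shows "face G act n i f' gs = (\<Oplus>\<^bsub>M\<^esub>k\<in>A. add_pow M (s k) (face G act n i (f k) gs))"
proof -
  interpret h: abelian_group_hom M M "act (hd gs)"
    using tuples_simps[OF assms(1)]
    by (intro module_hom_abelian_group_hom[OF module_axioms module_axioms] act_hom)
  have "f k hs \<in> carrier M" if "k \<in> A" "hs \<in> tuples G n" for k hs
    using assms(3) that by (auto simp: cochain_apply)
  then show ?thesis
    using tuples_simps[OF assms(1)] merge_tuples[OF assms(1)] assms(4)
    by (auto simp: face_def h.hom_finsum h.hom_add_pow_int Pi_def intro!: M.finsum_cong')
qed

end

lemma compose_cochain:
  assumes "h \<in> module_hom R M M'" "f \<in> carrier (cochains G M n)"
  shows "compose (tuples G n) h f \<in> carrier (cochains G M' n)"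
  using assms by (auto simp: compose_def module_hom_closed cochain_apply)

text \<open>A face only evaluates its cochain and possibly acts, so an equivariant homomorphism
  passes through it and then through the signed sum. It is applied to scalar multiplication, to the
  inclusion of \<open>N\<close> and to the projection modulo \<open>K\<close>.\<close>

lemma coboundary_natural:
  assumes M: "rg_module R G M act" and M': "rg_module R G M' act'"
    and h: "h \<in> module_hom R M M'" and equiv: "\<And>g x. g \<in> carrier G \<Longrightarrow> x \<in> carrier M \<Longrightarrow> h (act g x) = act' g (h x)"
    and f: "f \<in> carrier (cochains G M n)"
  shows "coboundary G M' act' n (compose (tuples G n) h f) = compose (tuples G (Suc n)) h (coboundary G M act n f)"
proof -
  interpret M: rg_module R G M act by fact
  interpret M': rg_module R G M' act' by fact
  interpret h: abelian_group_hom M M' h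
    using M.module_axioms M'.module_axioms h by (rule module_hom_abelian_group_hom)
  have hf: "compose (tuples G n) h f \<in> carrier (cochains G M' n)"
    using compose_cochain[OF h f] .
  have "face G act' n i (compose (tuples G n) h f) gs = h (face G act n i f gs)"
    if "gs \<in> tuples G (Suc n)" for i gs
    using that f tuples_simps[OF that] M.merge_tuples[OF that]
    by (auto simp: face_def cochain_apply compose_def equiv)
  then have eq: "coboundary G M' act' n (compose (tuples G n) h f) gs = compose (tuples G (Suc n)) h (coboundary G M act n f) gs"
    if "gs \<in> tuples G (Suc n)" for gs
    using that M'.coboundary_eq[OF hf that] M.coboundary_eq[OF f that] M.face_closed[OF f that]
    by (simp add: compose_eq h.hom_finsum h.hom_add_pow_int Pi_def del: M.finsum_Suc M'.finsum_Suc)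
  show ?thesis
    using M'.coboundary_closed[OF hf] compose_cochain[OF h M.coboundary_closed[OF f]] eq
    unfolding cochains_simps by (rule PiE_ext)
qed

context rg_module
begin

lemma coboundary_coboundary:
  assumes f: "f \<in> carrier (cochains G M n)"
  shows "coboundary G M act (Suc n) (coboundary G M act n f) = \<zero>\<^bsub>cochains G M (Suc (Suc n))\<^esub>"
proof -
  have df: "coboundary G M act n f \<in> carrier (cochains G M (Suc n))"
    using coboundary_closed[OF f] .
  have ff: "restrict (face G act n i f) (tuples G (Suc n)) \<in> carrier (cochains G M (Suc n))" for i
    using face_closed[OF f] by auto
  have "coboundary G M act (Suc n) (coboundary G M act n f) gs = \<zero>\<^bsub>M\<^esub>" if gs: "gs \<in> tuples G (Suc (Suc n))" for gs
  proof -
    \<comment> \<open>A face takes values off the tuples too, so the inner one is restricted to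
      become a cochain; \<open>D_face\<close> removes the restriction again.\<close>
    define D where "D j i = face G act (Suc n) j (restrict (face G act n i f) (tuples G (Suc n))) gs" for j i
    have D: "D j i \<in> carrier M" for j i
      unfolding D_def using face_closed[OF ff gs] .
    have D_face: "D j i = face G act (Suc n) j (face G act n i f) gs" for j i
      using tuples_simps[OF gs] merge_tuples[OF gs] by (auto simp: D_def face_def)
    have "coboundary G M act (Suc n) (coboundary G M act n f) gs
        = (\<Oplus>\<^bsub>M\<^esub>j\<in>{..Suc (Suc n)}. add_pow M ((-1::int) ^ j)
            (\<Oplus>\<^bsub>M\<^esub>i\<in>{..Suc n}. add_pow M ((-1::int) ^ i) (D j i)))"
    proof -
      have "face G act (Suc n) j (coboundary G M act n f) gs
          = (\<Oplus>\<^bsub>M\<^esub>i\<in>{..Suc n}. add_pow M ((-1::int) ^ i) (D j i))" for j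
        unfolding D_def by (rule face_additive[OF gs _ ff]) (simp_all add: coboundary_eq[OF f])
      then show ?thesis using coboundary_eq[OF df gs] by simp
    qed
    also have "\<dots> = (\<Oplus>\<^bsub>M\<^esub>j\<in>{..Suc (Suc n)}. \<Oplus>\<^bsub>M\<^esub>i\<in>{..Suc n}. add_pow M ((-1::int) ^ (i + j)) (D j i))"
    proof (intro M.finsum_cong' refl)
      fix j
      interpret h: abelian_group_hom M M "add_pow M ((-1::int) ^ j)"
        by (rule M.add_pow_int_group_hom)
      show "add_pow M ((-1::int) ^ j) (\<Oplus>\<^bsub>M\<^esub>i\<in>{..Suc n}. add_pow M ((-1::int) ^ i) (D j i))
          = (\<Oplus>\<^bsub>M\<^esub>i\<in>{..Suc n}. add_pow M ((-1::int) ^ (i + j)) (D j i))"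
        using D by (subst h.hom_finsum) (simp_all add: Pi_def M.add.int_pow_pow power_add)
    qed (use D in \<open>auto intro!: M.finsum_closed\<close>)
    also have "\<dots> = \<zero>\<^bsub>M\<^esub>"
      using D face_face[OF f gs] by (intro M.alternating_double_sum) (auto simp: D_face)
    finally show ?thesis .
  qed
  then show ?thesis
    using coboundary_closed[OF df] by (intro PiE_ext[of _ "tuples G (Suc (Suc n))" "\<lambda>_. carrier M"]) auto
qed

lemma coboundary_hom: "coboundary G M act n \<in> module_hom R (cochains G M n) (cochains G M (Suc n))"
proof (rule module_homI)
  fix f f' assume f: "f \<in> carrier (cochains G M n)" and f': "f' \<in> carrier (cochains G M n)"
  interpret C: module R "cochains G M n" by (intro cochains_module module_axioms)
  have ff: "f \<oplus>\<^bsub>cochains G M n\<^esub> f' \<in> carrier (cochains G M n)"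
    using f f' by (rule C.a_closed)
  have "face G act n i (f \<oplus>\<^bsub>cochains G M n\<^esub> f') gs = face G act n i f gs \<oplus>\<^bsub>M\<^esub> face G act n i f' gs"
    if "gs \<in> tuples G (Suc n)" for i gs
    using that f f' tuples_simps[OF that] merge_tuples[OF that]
    by (auto simp: face_def cochain_apply act_add)
  then have eq: "coboundary G M act n (f \<oplus>\<^bsub>cochains G M n\<^esub> f') gs
      = (coboundary G M act n f \<oplus>\<^bsub>cochains G M (Suc n)\<^esub> coboundary G M act n f') gs"
    if "gs \<in> tuples G (Suc n)" for gs
    using that coboundary_eq[OF ff that] coboundary_eq[OF f that] coboundary_eq[OF f' that]
      face_closed[OF f that] face_closed[OF f' that]
    by (simp add: M.add.int_pow_distrib M.finsum_addf Pi_def del: M.finsum_Suc)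
  interpret C': module R "cochains G M (Suc n)" by (intro cochains_module module_axioms)
  show "coboundary G M act n (f \<oplus>\<^bsub>cochains G M n\<^esub> f')
      = coboundary G M act n f \<oplus>\<^bsub>cochains G M (Suc n)\<^esub> coboundary G M act n f'"
    using coboundary_closed[OF ff] C'.a_closed[OF coboundary_closed[OF f] coboundary_closed[OF f']] eq
    unfolding cochains_simps(1) by (rule PiE_ext)
next
  fix a f assume a: "a \<in> carrier R" and f: "f \<in> carrier (cochains G M n)"
  show "coboundary G M act n (a \<odot>\<^bsub>cochains G M n\<^esub> f) = a \<odot>\<^bsub>cochains G M (Suc n)\<^esub> coboundary G M act n f"
    using coboundary_natural[OF rg_module_axioms rg_module_axioms smult_hom[OF a] _ f] a
    by (simp add: act_smult compose_def)
qed (rule coboundary_closed)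

section \<open>Annihilation of positive degree cohomology by the group order\<close>

lemma sum_over_last_closed:
  assumes "z \<in> carrier (cochains G M (Suc n))"
  shows "(\<lambda>gs\<in>tuples G n. \<Oplus>\<^bsub>M\<^esub>g\<in>carrier G. z (gs @ [g])) \<in> carrier (cochains G M n)"
  using assms by (auto intro!: M.finsum_closed cochain_apply[of z G "Suc n"] tuples_append)

text \<open>
  Summing the cocycle identity over the last argument exhibits \<open>|G| z\<close> as, up to sign, the
  coboundary of \<open>(g\<^sub>1, \<dots>, g\<^sub>n) \<mapsto> \<Sum>\<^sub>g z (g\<^sub>1, \<dots>, g\<^sub>n, g)\<close>.
\<close>

lemma order_annihilates_cohomology:
  assumes fin: "finite (carrier G)" and z: "z \<in> carrier (cochains G M (Suc n))"
    and dz: "coboundary G M act (Suc n) z = \<zero>\<^bsub>cochains G M (Suc (Suc n))\<^esub>"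
  shows "\<exists>y\<in>carrier (cochains G M n). add_pow (cochains G M (Suc n)) (order G) z = coboundary G M act n y"
proof -
  define s where "s = (\<lambda>gs\<in>tuples G n. \<Oplus>\<^bsub>M\<^esub>g\<in>carrier G. z (gs @ [g]))"
  have s: "s \<in> carrier (cochains G M n)"
    unfolding s_def using sum_over_last_closed[OF z] .
  have key: "add_pow M (order G) (z gs) = add_pow M ((-1::int) ^ Suc n) (coboundary G M act n s gs)"
    if gs: "gs \<in> tuples G (Suc n)" for gs
  proof -
    have zM: "z hs \<in> carrier M" if "hs \<in> tuples G (Suc n)" for hs
      using z that by (simp add: cochain_apply)
    have app: "gs @ [g] \<in> tuples G (Suc (Suc n))" if "g \<in> carrier G" for g
      using tuples_append[OF gs that] .
    define t where "t i g = face G act (Suc n) i z (gs @ [g])" for i g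
    have t: "t i g \<in> carrier M" if "g \<in> carrier G" for i g
      unfolding t_def using face_closed[OF z app[OF that]] .
    have len: "length gs = Suc n" using gs by (simp add: tuples_def)
    \<comment> \<open>Summation over the appended \<open>g\<close> turns every face of
      \<open>z\<close> but the last into the face of \<open>s\<close> with the same index: for
      \<open>i = 0\<close> by additivity of the action, for \<open>i\<close> up to \<open>n\<close>
      because \<open>g\<close> is untouched, and for \<open>i = n + 1\<close> by
      translation.\<close>
    have sum_t: "(\<Oplus>\<^bsub>M\<^esub>g\<in>carrier G. t i g) = face G act n i s gs" if "i \<le> Suc n" for i
    proof -
      consider "i = 0" | "1 \<le> i" "i \<le> n" | "i = Suc n" using \<open>i \<le> Suc n\<close> by linarith
      then show ?thesis
      proof cases
        case 1
        interpret h: abelian_group_hom M M "act (hd gs)"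
          using tuples_simps[OF gs]
          by (intro module_hom_abelian_group_hom[OF module_axioms module_axioms] act_hom)
        have "gs \<noteq> []" using len by auto
        then show ?thesis
          using 1 tuples_simps(2)[OF gs] tuples_append[OF tuples_simps(2)[OF gs]] zM
          by (simp add: t_def face_def s_def h.hom_finsum Pi_def)
      next
        case 2
        then show ?thesis
          using merge_tuples[OF gs, of i] merge_append[of i gs G] len
          by (simp add: t_def face_def s_def)
      next
        case 3
        obtain hs h where hs: "gs = hs @ [h]" using tuples_simps(5)[OF gs] by blast
        have h: "h \<in> carrier G" "hs \<in> tuples G n" and len': "length hs = n"
          using gs by (auto simp: tuples_def hs)
        \<comment> \<open>This inner face multiplies \<open>g\<close> into the last entry
          \<open>h\<close>. As \<open>g\<close> runs through the group so does the product, so the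
          sum forgets \<open>h\<close> and becomes the last face of \<open>s\<close>.\<close>
        have merge: "merge G (Suc n) (hs @ [h, g]) = hs @ [h \<otimes>\<^bsub>G\<^esub> g]" for g
          using merge_last[of G hs h g] len' by (simp add: hs)
        have "(\<Oplus>\<^bsub>M\<^esub>g\<in>carrier G. z (hs @ [g])) = (\<Oplus>\<^bsub>M\<^esub>g\<in>(\<lambda>g. h \<otimes>\<^bsub>G\<^esub> g) ` carrier G. z (hs @ [g]))"
          using surj_const_mult[OF h(1)] by simp
        also have "\<dots> = (\<Oplus>\<^bsub>M\<^esub>g\<in>carrier G. z (hs @ [h \<otimes>\<^bsub>G\<^esub> g]))"
          using h inj_on_cmult[OF h(1)] by (intro M.finsum_reindex) (auto intro!: zM tuples_append)
        finally show ?thesis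
          using 3 h by (simp add: t_def face_def s_def merge hs)
      qed
    qed
    \<comment> \<open>The remaining face drops \<open>g\<close>, so its sum over the group
      contributes the multiple of \<open>z gs\<close> by the group order.\<close>
    have last: "t (Suc (Suc n)) g = z gs" for g
      by (simp add: t_def face_def)
    define a where "a i g = add_pow M ((-1::int) ^ i) (t i g)" for i g
    have a: "a i g \<in> carrier M" if "g \<in> carrier G" for i g
      using t[OF that] by (simp add: a_def)
    have row: "a (Suc (Suc n)) g \<oplus>\<^bsub>M\<^esub> (\<Oplus>\<^bsub>M\<^esub>i\<in>{..Suc n}. a i g) = \<zero>\<^bsub>M\<^esub>" if g: "g \<in> carrier G" for g
    proof -
      have "(\<Oplus>\<^bsub>M\<^esub>i\<in>{..Suc (Suc n)}. a i g) = \<zero>\<^bsub>M\<^esub>"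
        using coboundary_eq[OF z app[OF g]] app[OF g] unfolding a_def t_def dz by simp
      moreover have "(\<Oplus>\<^bsub>M\<^esub>i\<in>{..Suc (Suc n)}. a i g) = a (Suc (Suc n)) g \<oplus>\<^bsub>M\<^esub> (\<Oplus>\<^bsub>M\<^esub>i\<in>{..Suc n}. a i g)"
        using a[OF g] by (intro M.finsum_Suc) auto
      ultimately show ?thesis by simp
    qed
    have "(\<Oplus>\<^bsub>M\<^esub>g\<in>carrier G. a (Suc (Suc n)) g) \<oplus>\<^bsub>M\<^esub> (\<Oplus>\<^bsub>M\<^esub>g\<in>carrier G. \<Oplus>\<^bsub>M\<^esub>i\<in>{..Suc n}. a i g)
        = (\<Oplus>\<^bsub>M\<^esub>g\<in>carrier G. a (Suc (Suc n)) g \<oplus>\<^bsub>M\<^esub> (\<Oplus>\<^bsub>M\<^esub>i\<in>{..Suc n}. a i g))"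
      using a by (intro M.finsum_addf[symmetric]) (auto intro!: M.finsum_closed)
    also have "\<dots> = \<zero>\<^bsub>M\<^esub>"
      using row by (intro M.add.finprod_one_eqI)
    finally have total: "(\<Oplus>\<^bsub>M\<^esub>g\<in>carrier G. a (Suc (Suc n)) g)
        \<oplus>\<^bsub>M\<^esub> (\<Oplus>\<^bsub>M\<^esub>g\<in>carrier G. \<Oplus>\<^bsub>M\<^esub>i\<in>{..Suc n}. a i g) = \<zero>\<^bsub>M\<^esub>" .
    have zgs: "z gs \<in> carrier M" using zM[OF gs] .
    have "(\<Oplus>\<^bsub>M\<^esub>g\<in>carrier G. a (Suc (Suc n)) g) = add_pow M (order G) (add_pow M ((-1::int) ^ Suc (Suc n)) (z gs))"
      unfolding a_def last order_def using zgs by (intro M.add.finprod_const) simp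
    moreover have "(\<Oplus>\<^bsub>M\<^esub>g\<in>carrier G. \<Oplus>\<^bsub>M\<^esub>i\<in>{..Suc n}. a i g) = coboundary G M act n s gs"
    proof -
      have "(\<Oplus>\<^bsub>M\<^esub>g\<in>carrier G. \<Oplus>\<^bsub>M\<^esub>i\<in>{..Suc n}. a i g) = (\<Oplus>\<^bsub>M\<^esub>i\<in>{..Suc n}. \<Oplus>\<^bsub>M\<^esub>g\<in>carrier G. a i g)"
        using a by (intro M.finsum_swap_atMost) auto
      also have "\<dots> = (\<Oplus>\<^bsub>M\<^esub>i\<in>{..Suc n}. add_pow M ((-1::int) ^ i) (face G act n i s gs))"
      proof (intro M.finsum_cong' refl)
        fix i assume i: "i \<in> {..Suc n}"
        interpret h: abelian_group_hom M M "add_pow M ((-1::int) ^ i)"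
          by (rule M.add_pow_int_group_hom)
        show "(\<Oplus>\<^bsub>M\<^esub>g\<in>carrier G. a i g) = add_pow M ((-1::int) ^ i) (face G act n i s gs)"
          using sum_t[of i] i t by (auto simp: a_def Pi_def simp flip: h.hom_finsum)
      qed (use face_closed[OF s gs] in auto)
      finally show ?thesis using coboundary_eq[OF s gs] by simp
    qed
    ultimately have "add_pow M (order G) (add_pow M ((-1::int) ^ Suc (Suc n)) (z gs))
        \<oplus>\<^bsub>M\<^esub> coboundary G M act n s gs = \<zero>\<^bsub>M\<^esub>"
      using total by simp
    moreover have "coboundary G M act n s gs \<in> carrier M"
      using coboundary_closed[OF s] gs by (auto intro: cochain_apply)
    moreover have "add_pow M (order G) (\<ominus>\<^bsub>M\<^esub> z gs) = \<ominus>\<^bsub>M\<^esub> add_pow M (order G) (z gs)"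
      using zgs by (simp add: M.add.nat_pow_inv)
    \<comment> \<open>The multiple of \<open>z gs\<close> carries the sign of exponent
      \<open>n + 2\<close>; solving for it depends on the parity of \<open>n\<close>.\<close>
    ultimately show ?thesis
      using zgs M.minus_equality[of "add_pow M (order G) (z gs)" "coboundary G M act n s gs"]
        M.minus_equality[of "coboundary G M act n s gs" "add_pow M (order G) (z gs)"]
        M.minus_equality[of "coboundary G M act n s gs" "\<ominus>\<^bsub>M\<^esub> add_pow M (order G) (z gs)"]
        M.a_comm[of "coboundary G M act n s gs" "\<ominus>\<^bsub>M\<^esub> add_pow M (order G) (z gs)"]
      by (cases "even n") (simp_all add: M.add.int_pow_neg)
  qed
  \<comment> \<open>The sign is absorbed into the primitive.\<close>
  let ?y = "add_pow (cochains G M n) ((-1::int) ^ Suc n) s"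
  interpret C: module R "cochains G M n" by (intro cochains_module module_axioms)
  interpret C': module R "cochains G M (Suc n)" by (intro cochains_module module_axioms)
  have y: "?y \<in> carrier (cochains G M n)"
    using s by (rule C.add.int_pow_closed)
  have w: "add_pow (cochains G M (Suc n)) (order G) z \<in> carrier (cochains G M (Suc n))"
    using z by (rule C'.add.nat_pow_closed)
  have "add_pow (cochains G M (Suc n)) (order G) z gs = coboundary G M act n ?y gs"
    if gs: "gs \<in> tuples G (Suc n)" for gs
  proof -
    have "coboundary G M act n ?y = add_pow (cochains G M (Suc n)) ((-1::int) ^ Suc n) (coboundary G M act n s)"
      by (rule abelian_group_hom.hom_add_pow_int[OF module_hom_abelian_group_hom[OF
            C.module_axioms C'.module_axioms coboundary_hom] s])
    then show ?thesis
      using key[OF gs] cochains_add_pow_apply[OF module_axioms z gs]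
        cochains_add_pow_int_apply[OF module_axioms coboundary_closed[OF s] gs] by simp
  qed
  then have "add_pow (cochains G M (Suc n)) (order G) z = coboundary G M act n ?y"
    using w coboundary_closed[OF y]
    by (intro PiE_ext[of _ "tuples G (Suc n)" "\<lambda>_. carrier M"]) auto
  then show ?thesis using y by blast
qed

end

section \<open>The splitting for complexes of modules\<close>

text \<open>
  The complex \<open>C\<close>, its subcomplex \<open>S\<close> and \<open>Q = C / u q\<^sup>2 S\<close> stand for the cochains with values in
  \<open>M\<close>, \<open>N\<close> and \<open>M / p\<^sup>r N\<close>, where \<open>q = p\<^sup>m\<close> and \<open>u = p\<^bsup>r - 2m\<^esup>\<close>. \<open>HC k\<close>, \<open>HS k\<close> and
  \<open>HQ k\<close> are the cohomology in degree \<open>k + 1\<close>.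
\<close>

locale split_complex =
  fixes R :: "('r, 'a) ring_scheme"
    and C :: "nat \<Rightarrow> ('r, 'x, 'c) module_scheme" and d :: "nat \<Rightarrow> 'x \<Rightarrow> 'x" and S :: "nat \<Rightarrow> 'x set"
    and Q :: "nat \<Rightarrow> ('r, 'y, 'e) module_scheme" and e :: "nat \<Rightarrow> 'y \<Rightarrow> 'y" and \<pi> :: "nat \<Rightarrow> 'x \<Rightarrow> 'y"
    and u q :: nat
  assumes C_module: "module R (C k)"
    and d_hom: "d k \<in> module_hom R (C k) (C (Suc k))"
    and d_d: "x \<in> carrier (C k) \<Longrightarrow> d (Suc k) (d k x) = \<zero>\<^bsub>C (Suc (Suc k))\<^esub>"
    and S_submodule: "submodule (S k) R (C k)"
    and d_S: "x \<in> S k \<Longrightarrow> d k x \<in> S (Suc k)"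
    and Q_module: "module R (Q k)"
    and e_hom: "e k \<in> module_hom R (Q k) (Q (Suc k))"
    and \<pi>_hom: "\<pi> k \<in> module_hom R (C k) (Q k)"
    and \<pi>_surj: "\<pi> k ` carrier (C k) = carrier (Q k)"
    and \<pi>_d: "x \<in> carrier (C k) \<Longrightarrow> \<pi> (Suc k) (d k x) = e k (\<pi> k x)"
    and \<pi>_kernel: "x \<in> carrier (C k) \<Longrightarrow>
      \<pi> k x = \<zero>\<^bsub>Q k\<^esub> \<longleftrightarrow> (\<exists>s\<in>S k. x = add_pow (C k) (u * q * q) s)"
    and torsion_free: "s \<in> S k \<Longrightarrow> add_pow (C k) (u * q * q) s = \<zero>\<^bsub>C k\<^esub> \<Longrightarrow> s = \<zero>\<^bsub>C k\<^esub>"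
    and annihilate: "z \<in> S (Suc k) \<Longrightarrow> d (Suc k) z = \<zero>\<^bsub>C (Suc (Suc k))\<^esub> \<Longrightarrow>
      \<exists>y\<in>S k. add_pow (C (Suc k)) q z = d k y"
begin

section \<open>Cocycles, coboundaries and cohomology of the three complexes\<close>

definition "Z k = {x \<in> carrier (C k). d k x = \<zero>\<^bsub>C (Suc k)\<^esub>}"
definition "ZS k = {x \<in> S k. d k x = \<zero>\<^bsub>C (Suc k)\<^esub>}"
definition "ZQ k = {x \<in> carrier (Q k). e k x = \<zero>\<^bsub>Q (Suc k)\<^esub>}"

definition "BC k = d k ` carrier (C k)"
definition "BS k = d k ` S k"
definition "BQ k = e k ` carrier (Q k)"

definition "HC k = quot_module ((C (Suc k))\<lparr>carrier := Z (Suc k)\<rparr>) (BC k)"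
definition "HS k = quot_module ((C (Suc k))\<lparr>carrier := ZS (Suc k)\<rparr>) (BS k)"
definition "HQ k = quot_module ((Q (Suc k))\<lparr>carrier := ZQ (Suc k)\<rparr>) (BQ k)"

text \<open>The primitive \<open>b\<close> is part of the data instead of a chosen function of
  \<open>c\<close>, so that a map of complexes carries such triples to such triples. Note the
  degrees: \<open>z\<close> and \<open>b\<close> live in degree \<open>k + 1\<close>, but
  \<open>c\<close> in degree \<open>k + 2\<close>.\<close>

definition split_data :: "nat \<Rightarrow> 'x \<Rightarrow> 'x \<Rightarrow> 'x \<Rightarrow> bool" where
  "split_data k z c b \<longleftrightarrow> z \<in> Z (Suc k) \<and> c \<in> ZS (Suc (Suc k)) \<and> b \<in> S (Suc k) \<and>
    d (Suc k) b = add_pow (C (Suc (Suc k))) q c"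

definition split_cochain :: "nat \<Rightarrow> 'x \<Rightarrow> 'x \<Rightarrow> 'x" where
  "split_cochain k z b = z \<oplus>\<^bsub>C (Suc k)\<^esub> add_pow (C (Suc k)) (u * q) b"

definition split_rel :: "nat \<Rightarrow> 'y set \<Rightarrow> 'x set \<times> 'x set \<Rightarrow> bool" where
  "split_rel k x y \<longleftrightarrow> (\<exists>z c b. split_data k z c b \<and>
    x = BQ k +>\<^bsub>Q (Suc k)\<^esub> \<pi> (Suc k) (split_cochain k z b) \<and>
    y = (BC k +>\<^bsub>C (Suc k)\<^esub> z, BS (Suc k) +>\<^bsub>C (Suc (Suc k))\<^esub> c))"

sublocale C: module R "C k" for k by (rule C_module)
sublocale Q: module R "Q k" for k by (rule Q_module)

lemmas d_simps = module_hom_closed[OF d_hom] module_hom_add[OF d_hom] module_hom_smult[OF d_hom]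
  module_hom_add_pow[OF C_module C_module d_hom] module_hom_minus[OF C_module C_module d_hom]
  module_hom_zero[OF C_module C_module d_hom]

lemmas \<pi>_simps = module_hom_closed[OF \<pi>_hom] module_hom_add[OF \<pi>_hom] module_hom_smult[OF \<pi>_hom]
  module_hom_add_pow[OF C_module Q_module \<pi>_hom] module_hom_minus[OF C_module Q_module \<pi>_hom]
  module_hom_zero[OF C_module Q_module \<pi>_hom]

lemma S_carrier: "x \<in> S k \<Longrightarrow> x \<in> carrier (C k)"
  using C.mem_submodule[OF S_submodule] .

lemma e_e:
  assumes "y \<in> carrier (Q k)"
  shows "e (Suc k) (e k y) = \<zero>\<^bsub>Q (Suc (Suc k))\<^esub>"
proof -
  obtain x where x: "x \<in> carrier (C k)" "y = \<pi> k x"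
    using assms unfolding \<pi>_surj[symmetric] by blast
  then have "e (Suc k) (e k y) = \<pi> (Suc (Suc k)) (d (Suc k) (d k x))"
    using \<pi>_d[OF x(1)] \<pi>_d[OF d_simps(1)[OF x(1)]] by simp
  then show ?thesis using d_d[OF x(1)] \<pi>_simps(6) by simp
qed

lemma Z_submodule: "submodule (Z k) R (C k)"
  unfolding Z_def using C_module C_module d_hom by (rule kernel_submodule)

lemma ZQ_submodule: "submodule (ZQ k) R (Q k)"
  unfolding ZQ_def using Q_module Q_module e_hom by (rule kernel_submodule)

lemma ZS_submodule: "submodule (ZS k) R (C k)"
proof -
  have "ZS k = S k \<inter> Z k"
    using S_carrier by (auto simp: ZS_def Z_def)
  then show ?thesis
    using C.submoduleE[OF S_submodule[of k]] C.submoduleE[OF Z_submodule[of k]]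
      C.submodule_zero[OF S_submodule[of k]] C.submodule_zero[OF Z_submodule[of k]]
    by (intro C.submoduleI) auto
qed

lemma B_submodules:
  "submodule (BC k) R (C (Suc k))" "submodule (BS k) R (C (Suc k))" "submodule (BQ k) R (Q (Suc k))"
  unfolding BC_def BS_def BQ_def
  using image_submodule[OF C_module C_module d_hom] image_submodule[OF Q_module Q_module e_hom]
    C.carrier_is_submodule Q.carrier_is_submodule S_submodule by auto

lemma B_le_Z: "BC k \<subseteq> Z (Suc k)" "BS k \<subseteq> ZS (Suc k)" "BQ k \<subseteq> ZQ (Suc k)"
  using d_simps(1) d_d d_S S_carrier e_e module_hom_closed[OF e_hom]
  by (auto simp: Z_def ZS_def ZQ_def BC_def BS_def BQ_def)

lemma H_modules: "module R (HC k)" "module R (HS k)" "module R (HQ k)"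
  unfolding HC_def HS_def HQ_def
  by (intro subquotient_module C_module Q_module B_submodules B_le_Z Z_submodule ZS_submodule ZQ_submodule)+

lemma H_carrier:
  "carrier (HC k) = (\<lambda>x. BC k +>\<^bsub>C (Suc k)\<^esub> x) ` Z (Suc k)"
  "carrier (HS k) = (\<lambda>x. BS k +>\<^bsub>C (Suc k)\<^esub> x) ` ZS (Suc k)"
  "carrier (HQ k) = (\<lambda>x. BQ k +>\<^bsub>Q (Suc k)\<^esub> x) ` ZQ (Suc k)"
  by (simp_all add: HC_def HS_def HQ_def quot_module_restrict_carrier)

lemma H_zero: "\<zero>\<^bsub>HC k\<^esub> = BC k" "\<zero>\<^bsub>HS k\<^esub> = BS k" "\<zero>\<^bsub>HQ k\<^esub> = BQ k"
  by (simp_all add: HC_def HS_def HQ_def)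

text \<open>Stated for arbitrary cochains, since the operations of a subquotient are those of the
  full quotient.\<close>

lemma H_add:
  "\<lbrakk>x \<in> carrier (C (Suc k)); y \<in> carrier (C (Suc k))\<rbrakk> \<Longrightarrow>
    (BC k +>\<^bsub>C (Suc k)\<^esub> x) \<oplus>\<^bsub>HC k\<^esub> (BC k +>\<^bsub>C (Suc k)\<^esub> y) = BC k +>\<^bsub>C (Suc k)\<^esub> (x \<oplus>\<^bsub>C (Suc k)\<^esub> y)"
  "\<lbrakk>x \<in> carrier (C (Suc k)); y \<in> carrier (C (Suc k))\<rbrakk> \<Longrightarrow>
    (BS k +>\<^bsub>C (Suc k)\<^esub> x) \<oplus>\<^bsub>HS k\<^esub> (BS k +>\<^bsub>C (Suc k)\<^esub> y) = BS k +>\<^bsub>C (Suc k)\<^esub> (x \<oplus>\<^bsub>C (Suc k)\<^esub> y)"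
  "\<lbrakk>x' \<in> carrier (Q (Suc k)); y' \<in> carrier (Q (Suc k))\<rbrakk> \<Longrightarrow>
    (BQ k +>\<^bsub>Q (Suc k)\<^esub> x') \<oplus>\<^bsub>HQ k\<^esub> (BQ k +>\<^bsub>Q (Suc k)\<^esub> y') = BQ k +>\<^bsub>Q (Suc k)\<^esub> (x' \<oplus>\<^bsub>Q (Suc k)\<^esub> y')"
  using C.quot_add[OF B_submodules(1)] C.quot_add[OF B_submodules(2)] Q.quot_add[OF B_submodules(3)]
  by (simp_all add: HC_def HS_def HQ_def quot_module_restrict_carrier)

lemma H_smult:
  "\<lbrakk>a \<in> carrier R; x \<in> carrier (C (Suc k))\<rbrakk> \<Longrightarrow>
    a \<odot>\<^bsub>HC k\<^esub> (BC k +>\<^bsub>C (Suc k)\<^esub> x) = BC k +>\<^bsub>C (Suc k)\<^esub> (a \<odot>\<^bsub>C (Suc k)\<^esub> x)"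
  "\<lbrakk>a \<in> carrier R; x \<in> carrier (C (Suc k))\<rbrakk> \<Longrightarrow>
    a \<odot>\<^bsub>HS k\<^esub> (BS k +>\<^bsub>C (Suc k)\<^esub> x) = BS k +>\<^bsub>C (Suc k)\<^esub> (a \<odot>\<^bsub>C (Suc k)\<^esub> x)"
  "\<lbrakk>a \<in> carrier R; x' \<in> carrier (Q (Suc k))\<rbrakk> \<Longrightarrow>
    a \<odot>\<^bsub>HQ k\<^esub> (BQ k +>\<^bsub>Q (Suc k)\<^esub> x') = BQ k +>\<^bsub>Q (Suc k)\<^esub> (a \<odot>\<^bsub>Q (Suc k)\<^esub> x')"
  using C.quot_smult[OF B_submodules(1)] C.quot_smult[OF B_submodules(2)] Q.quot_smult[OF B_submodules(3)]
  by (simp_all add: HC_def HS_def HQ_def quot_module_restrict_carrier)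

lemma split_data_carrier:
  assumes "split_data k z c b"
  shows "z \<in> carrier (C (Suc k))" "c \<in> carrier (C (Suc (Suc k)))" "b \<in> carrier (C (Suc k))"
    "split_cochain k z b \<in> carrier (C (Suc k))"
  using assms S_carrier by (auto simp: split_data_def Z_def ZS_def split_cochain_def)

text \<open>This computes the connecting homomorphism on the class of
  \<open>split_cochain k z b\<close>: dividing its coboundary by \<open>u * q * q\<close> returns
  \<open>c\<close>.\<close>

lemma d_total:
  assumes "split_data k z c b"
  shows "d (Suc k) (split_cochain k z b) = add_pow (C (Suc (Suc k))) (u * q * q) c"
  using assms split_data_carrier[OF assms]
  by (simp add: split_cochain_def d_simps split_data_def Z_def C.add.nat_pow_pow mult.assoc mult.commute)

lemma \<pi>_total:
  assumes "split_data k z c b"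
  shows "\<pi> (Suc k) (split_cochain k z b) \<in> ZQ (Suc k)"
proof -
  have "e (Suc k) (\<pi> (Suc k) (split_cochain k z b)) = \<pi> (Suc (Suc k)) (add_pow (C (Suc (Suc k))) (u * q * q) c)"
    using \<pi>_d split_data_carrier(4)[OF assms] d_total[OF assms] by metis
  also have "\<dots> = \<zero>\<^bsub>Q (Suc (Suc k))\<^esub>"
    using assms split_data_carrier(2)[OF assms]
    by (subst \<pi>_kernel) (auto simp: split_data_def ZS_def)
  finally show ?thesis
    using split_data_carrier(4)[OF assms] \<pi>_simps(1) by (simp add: ZQ_def)
qed

section \<open>The graph: linear, total on both sides and trivial over zero\<close>

lemma split_rel_carrier:
  "split_rel k x y \<Longrightarrow> x \<in> carrier (HQ k) \<and> y \<in> carrier (module_sum (HC k) (HS (Suc k)))"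
  using \<pi>_total by (auto simp: split_rel_def H_carrier split_data_def)

lemma split_data_add:
  assumes D: "split_data k z c b" and D': "split_data k z' c' b'"
  shows "split_data k (z \<oplus>\<^bsub>C (Suc k)\<^esub> z') (c \<oplus>\<^bsub>C (Suc (Suc k))\<^esub> c') (b \<oplus>\<^bsub>C (Suc k)\<^esub> b')"
    and "split_cochain k (z \<oplus>\<^bsub>C (Suc k)\<^esub> z') (b \<oplus>\<^bsub>C (Suc k)\<^esub> b') = split_cochain k z b \<oplus>\<^bsub>C (Suc k)\<^esub> split_cochain k z' b'"
  using split_data_carrier[OF D] split_data_carrier[OF D'] D D'
    C.submoduleE(5)[OF Z_submodule] C.submoduleE(5)[OF ZS_submodule] C.submoduleE(5)[OF S_submodule]
  by (auto simp: split_data_def split_cochain_def d_simps C.add.nat_pow_distrib C.a_ac)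

lemma split_data_smult:
  assumes D: "split_data k z c b" and a: "a \<in> carrier R"
  shows "split_data k (a \<odot>\<^bsub>C (Suc k)\<^esub> z) (a \<odot>\<^bsub>C (Suc (Suc k))\<^esub> c) (a \<odot>\<^bsub>C (Suc k)\<^esub> b)"
    and "split_cochain k (a \<odot>\<^bsub>C (Suc k)\<^esub> z) (a \<odot>\<^bsub>C (Suc k)\<^esub> b) = a \<odot>\<^bsub>C (Suc k)\<^esub> split_cochain k z b"
  using split_data_carrier[OF D] D a module_hom_smult[OF C.add_pow_hom a]
    C.submoduleE(4)[OF Z_submodule] C.submoduleE(4)[OF ZS_submodule] C.submoduleE(4)[OF S_submodule]
  by (auto simp: split_data_def split_cochain_def d_simps C.smult_r_distr)

text \<open>A cocycle of \<open>Q\<close> lifts to some \<open>g\<close> with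
  \<open>d g = u q q c\<close>. Since d d g = 0, torsion-freeness makes \<open>c\<close> a cocycle,
  so it has a primitive \<open>b\<close> after multiplication by \<open>q\<close>.\<close>

lemma split_rel_left:
  assumes "x \<in> carrier (HQ k)"
  shows "\<exists>y. split_rel k x y"
proof -
  obtain f where f: "f \<in> ZQ (Suc k)" "x = BQ k +>\<^bsub>Q (Suc k)\<^esub> f"
    using assms by (auto simp: H_carrier)
  then have "f \<in> \<pi> (Suc k) ` carrier (C (Suc k))"
    using \<pi>_surj by (simp add: ZQ_def)
  then obtain g where g: "g \<in> carrier (C (Suc k))" "f = \<pi> (Suc k) g" by blast
  have "\<pi> (Suc (Suc k)) (d (Suc k) g) = \<zero>\<^bsub>Q (Suc (Suc k))\<^esub>"
    using \<pi>_d[OF g(1)] f g by (simp add: ZQ_def)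
  then obtain c where c: "c \<in> S (Suc (Suc k))" "d (Suc k) g = add_pow (C (Suc (Suc k))) (u * q * q) c"
    using \<pi>_kernel[of "d (Suc k) g" "Suc (Suc k)"] d_simps(1) g by blast
  have "add_pow (C (Suc (Suc (Suc k)))) (u * q * q) (d (Suc (Suc k)) c) = \<zero>\<^bsub>C (Suc (Suc (Suc k)))\<^esub>"
    using d_d[OF g(1)] c d_simps(4)[OF S_carrier[OF c(1)]] by simp
  then have dc: "d (Suc (Suc k)) c = \<zero>\<^bsub>C (Suc (Suc (Suc k)))\<^esub>"
    using torsion_free d_S[OF c(1)] by blast
  then obtain b where b: "b \<in> S (Suc k)" "add_pow (C (Suc (Suc k))) q c = d (Suc k) b"
    using annihilate c(1) by blast
  \<comment> \<open>Both \<open>g\<close> and \<open>u q b\<close> have coboundary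
    \<open>u q q c\<close>, so their difference is a cocycle of \<open>C\<close>.\<close>
  define z where "z = g \<ominus>\<^bsub>C (Suc k)\<^esub> add_pow (C (Suc k)) (u * q) b"
  have carr: "c \<in> carrier (C (Suc (Suc k)))" "b \<in> carrier (C (Suc k))"
    using b c S_carrier by auto
  have "d (Suc k) z = add_pow (C (Suc (Suc k))) (u * q * q) c
      \<ominus>\<^bsub>C (Suc (Suc k))\<^esub> add_pow (C (Suc (Suc k))) (u * q) (add_pow (C (Suc (Suc k))) q c)"
    using g carr by (simp add: z_def d_simps c flip: b(2))
  then have "d (Suc k) z = \<zero>\<^bsub>C (Suc (Suc k))\<^esub>"
    using carr by (simp add: C.add.nat_pow_pow mult.commute mult.left_commute C.minus_self)
  then have D: "split_data k z c b"
    using g c b carr dc by (simp add: split_data_def Z_def ZS_def z_def)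
  have "split_cochain k z b = g"
    using g carr by (simp add: split_cochain_def z_def a_minus_def C.a_assoc C.l_neg)
  then show ?thesis
    using D f g by (auto simp: split_rel_def)
qed

lemma split_rel_right:
  assumes "y \<in> carrier (module_sum (HC k) (HS (Suc k)))"
  shows "\<exists>x. split_rel k x y"
proof -
  obtain z c where zc: "z \<in> Z (Suc k)" "c \<in> ZS (Suc (Suc k))"
      "y = (BC k +>\<^bsub>C (Suc k)\<^esub> z, BS (Suc k) +>\<^bsub>C (Suc (Suc k))\<^esub> c)"
    using assms by (auto simp: H_carrier)
  moreover obtain b where "b \<in> S (Suc k)" "add_pow (C (Suc (Suc k))) q c = d (Suc k) b"
    using annihilate zc(2) by (auto simp: ZS_def)
  ultimately have "split_data k z c b" by (simp add: split_data_def)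
  with zc show ?thesis by (auto simp: split_rel_def)
qed

text \<open>The second factor \<open>q\<close> is spent here: \<open>b - q s\<close> is a cocycle in
  \<open>S\<close>, so \<open>q (b - q s)\<close> is the coboundary of an element of
  \<open>S\<close>; multiply by \<open>u\<close>. With \<open>s\<close> zero this is independence of
  the choice of \<open>b\<close>; general \<open>s\<close> allows \<open>c\<close> to vary by a
  coboundary.\<close>

lemma multiple_of_primitive:
  assumes b: "b \<in> S (Suc k)" and s: "s \<in> S (Suc k)"
    and eq: "d (Suc k) b = add_pow (C (Suc (Suc k))) q (d (Suc k) s)"
  shows "\<exists>t\<in>S k. add_pow (C (Suc k)) (u * q) b = d k t \<oplus>\<^bsub>C (Suc k)\<^esub> add_pow (C (Suc k)) (u * q * q) s"
proof -
  let ?w = "b \<ominus>\<^bsub>C (Suc k)\<^esub> add_pow (C (Suc k)) q s"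
  have carr: "b \<in> carrier (C (Suc k))" "s \<in> carrier (C (Suc k))"
    using b s S_carrier by auto
  have "?w \<in> S (Suc k)"
    using b s C.submodule_minus[OF S_submodule] C.submodule_add_pow[OF S_submodule] by blast
  moreover have "d (Suc k) ?w = \<zero>\<^bsub>C (Suc (Suc k))\<^esub>"
    using carr eq by (simp add: d_simps C.minus_self)
  ultimately obtain t where t: "t \<in> S k" "add_pow (C (Suc k)) q ?w = d k t"
    using annihilate by blast
  have tc: "t \<in> carrier (C k)" using t S_carrier by blast
  have "b = ?w \<oplus>\<^bsub>C (Suc k)\<^esub> add_pow (C (Suc k)) q s"
    using carr by (simp add: a_minus_def C.a_assoc C.l_neg)
  then have "add_pow (C (Suc k)) (u * q) b
      = add_pow (C (Suc k)) (u * q) ?w \<oplus>\<^bsub>C (Suc k)\<^esub> add_pow (C (Suc k)) (u * q) (add_pow (C (Suc k)) q s)"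
    using carr C.add.nat_pow_distrib[of ?w "Suc k" "add_pow (C (Suc k)) q s" "u * q"] by simp
  also have "add_pow (C (Suc k)) (u * q) ?w = add_pow (C (Suc k)) u (add_pow (C (Suc k)) q ?w)"
    using carr by (simp add: C.add.nat_pow_pow mult.commute)
  also have "\<dots> = d k (add_pow (C k) u t)"
    using t tc by (simp add: d_simps)
  also have "add_pow (C (Suc k)) (u * q) (add_pow (C (Suc k)) q s) = add_pow (C (Suc k)) (u * q * q) s"
    using carr by (simp add: C.add.nat_pow_pow mult.commute mult.left_commute)
  finally show ?thesis
    using C.submodule_add_pow[OF S_submodule t(1)] by blast
qed

text \<open>A vanishing class means \<open>z + u q b = d y' + u q q s\<close>. Applying
  \<open>d\<close> and cancelling \<open>u q q\<close> by torsion-freeness gives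
  \<open>c = d s\<close>. Then \<open>multiple_of_primitive\<close> rewrites \<open>u q b\<close> as
  \<open>d t + u q q s\<close>, and cancellation leaves \<open>z + d t = d y'\<close>.\<close>

lemma split_rel_zero_left:
  assumes "split_rel k \<zero>\<^bsub>HQ k\<^esub> y"
  shows "y = \<zero>\<^bsub>module_sum (HC k) (HS (Suc k))\<^esub>"
proof -
  let ?C = "C (Suc k)"
  obtain z c b where D: "split_data k z c b"
    and x: "BQ k = BQ k +>\<^bsub>Q (Suc k)\<^esub> \<pi> (Suc k) (split_cochain k z b)"
    and y: "y = (BC k +>\<^bsub>?C\<^esub> z, BS (Suc k) +>\<^bsub>C (Suc (Suc k))\<^esub> c)"
    using assms by (auto simp: split_rel_def H_zero)
  note carr = split_data_carrier[OF D]
  have "\<pi> (Suc k) (split_cochain k z b) \<in> BQ k"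
    using Q.coset_eq_self_iff[OF B_submodules(3), of "\<pi> (Suc k) (split_cochain k z b)"] x carr \<pi>_simps(1) by metis
  then obtain v where v: "v \<in> carrier (Q k)" "\<pi> (Suc k) (split_cochain k z b) = e k v"
    unfolding BQ_def by blast
  moreover obtain y' where y': "y' \<in> carrier (C k)" "v = \<pi> k y'"
    using v(1) unfolding \<pi>_surj[symmetric] by blast
  ultimately have "\<pi> (Suc k) (split_cochain k z b) = \<pi> (Suc k) (d k y')"
    using \<pi>_d[OF y'(1)] by metis
  then have "\<pi> (Suc k) (split_cochain k z b \<ominus>\<^bsub>?C\<^esub> d k y') = \<zero>\<^bsub>Q (Suc k)\<^esub>"
    using \<pi>_simps(5)[OF carr(4) d_simps(1)[OF y'(1)]] \<pi>_simps(1)[OF d_simps(1)[OF y'(1)]]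
    by (simp add: Q.minus_self)
  then obtain s where s: "s \<in> S (Suc k)" "split_cochain k z b \<ominus>\<^bsub>?C\<^esub> d k y' = add_pow ?C (u * q * q) s"
    using \<pi>_kernel carr y' d_simps(1) by (meson C.minus_closed)
  have sc: "s \<in> carrier ?C" using s S_carrier by blast
  have "add_pow (C (Suc (Suc k))) (u * q * q) (d (Suc k) s) = d (Suc k) (split_cochain k z b \<ominus>\<^bsub>?C\<^esub> d k y')"
    using sc by (simp add: s d_simps)
  also have "\<dots> = add_pow (C (Suc (Suc k))) (u * q * q) c"
    using carr y' by (simp add: d_simps d_d d_total[OF D] C.minus_zero)
  finally have "add_pow (C (Suc (Suc k))) (u * q * q) (c \<ominus>\<^bsub>C (Suc (Suc k))\<^esub> d (Suc k) s) = \<zero>\<^bsub>C (Suc (Suc k))\<^esub>"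
    using module_hom_minus[OF C_module C_module C.add_pow_hom carr(2) d_simps(1)[OF sc]] carr
    by (simp add: C.minus_self)
  moreover have "c \<in> S (Suc (Suc k))" using D by (simp add: split_data_def ZS_def)
  ultimately have c: "c = d (Suc k) s"
    using torsion_free C.submodule_minus[OF S_submodule _ d_S[OF s(1)]]
      C.minus_eq_zeroD[OF _ carr(2) d_simps(1)[OF sc]] by blast
  then obtain t where t: "t \<in> S k" "add_pow ?C (u * q) b = d k t \<oplus>\<^bsub>?C\<^esub> add_pow ?C (u * q * q) s"
    using multiple_of_primitive[of b k s] D s by (auto simp: split_data_def)
  have tc: "t \<in> carrier (C k)" using t S_carrier by blast
  have "split_cochain k z b = d k y' \<oplus>\<^bsub>?C\<^esub> add_pow ?C (u * q * q) s"
  proof -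
    have "split_cochain k z b = (split_cochain k z b \<ominus>\<^bsub>?C\<^esub> d k y') \<oplus>\<^bsub>?C\<^esub> d k y'"
      using carr d_simps(1)[OF y'(1)] by (simp add: a_minus_def C.a_assoc C.l_neg)
    then show ?thesis
      using sc d_simps(1)[OF y'(1)] unfolding s(2) by (simp add: C.a_comm)
  qed
  then have "(z \<oplus>\<^bsub>?C\<^esub> d k t) \<oplus>\<^bsub>?C\<^esub> add_pow ?C (u * q * q) s = d k y' \<oplus>\<^bsub>?C\<^esub> add_pow ?C (u * q * q) s"
    using carr tc d_simps(1) sc by (simp add: split_cochain_def t C.a_assoc)
  then have "z \<oplus>\<^bsub>?C\<^esub> d k t = d k y'"
    using carr tc y' d_simps(1) sc by simp
  then have "z = d k (y' \<ominus>\<^bsub>C k\<^esub> t)"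
    unfolding d_simps(5)[OF y'(1) tc] using carr(1) d_simps(1)[OF tc] by (rule C.eq_minusI)
  then have "z \<in> BC k" using y' tc by (auto simp: BC_def)
  moreover have "c \<in> BS (Suc k)" using c s by (auto simp: BS_def)
  ultimately show ?thesis
    using C.coset_eq_self_iff[OF B_submodules(1)] C.coset_eq_self_iff[OF B_submodules(2)] carr
    by (simp add: y H_zero)
qed

text \<open>If \<open>z = d y'\<close> and \<open>c = d s\<close>, then
  \<open>multiple_of_primitive\<close> makes \<open>z + u q b\<close> a coboundary plus
  \<open>u q q s\<close>, and the latter vanishes in \<open>Q\<close>.\<close>

lemma split_rel_zero_right:
  assumes "split_rel k x \<zero>\<^bsub>module_sum (HC k) (HS (Suc k))\<^esub>"
  shows "x = \<zero>\<^bsub>HQ k\<^esub>"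
proof -
  let ?C = "C (Suc k)"
  obtain z c b where D: "split_data k z c b"
    and x: "x = BQ k +>\<^bsub>Q (Suc k)\<^esub> \<pi> (Suc k) (split_cochain k z b)"
    and y: "BC k = BC k +>\<^bsub>?C\<^esub> z" "BS (Suc k) = BS (Suc k) +>\<^bsub>C (Suc (Suc k))\<^esub> c"
    using assms by (auto simp: split_rel_def H_zero)
  note carr = split_data_carrier[OF D]
  have "z \<in> BC k" "c \<in> BS (Suc k)"
    using C.coset_eq_self_iff[OF B_submodules(1) carr(1)] C.coset_eq_self_iff[OF B_submodules(2) carr(2)] y
    by auto
  then obtain y' s where y': "y' \<in> carrier (C k)" "z = d k y'" and s: "s \<in> S (Suc k)" "c = d (Suc k) s"
    by (auto simp: BC_def BS_def)
  obtain t where t: "t \<in> S k" "add_pow ?C (u * q) b = d k t \<oplus>\<^bsub>?C\<^esub> add_pow ?C (u * q * q) s"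
    using multiple_of_primitive[of b k s] D s by (auto simp: split_data_def)
  have sc: "s \<in> carrier ?C" and tc: "t \<in> carrier (C k)" using s t S_carrier by auto
  have "split_cochain k z b = d k (y' \<oplus>\<^bsub>C k\<^esub> t) \<oplus>\<^bsub>?C\<^esub> add_pow ?C (u * q * q) s"
    using y' tc sc by (simp add: split_cochain_def t d_simps C.a_assoc)
  moreover have "\<pi> (Suc k) (add_pow ?C (u * q * q) s) = \<zero>\<^bsub>Q (Suc k)\<^esub>"
    using \<pi>_kernel s sc by auto
  ultimately have "\<pi> (Suc k) (split_cochain k z b) = e k (\<pi> k (y' \<oplus>\<^bsub>C k\<^esub> t))"
    using y' tc sc \<pi>_d[of "y' \<oplus>\<^bsub>C k\<^esub> t" k] \<pi>_simps(1)[of "d k (y' \<oplus>\<^bsub>C k\<^esub> t)" "Suc k"] d_simps(1)[of _ k]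
    by (simp add: \<pi>_simps(2) del: \<pi>_d)
  then have "\<pi> (Suc k) (split_cochain k z b) \<in> BQ k"
    using y' tc \<pi>_simps(1) by (auto simp: BQ_def)
  then show ?thesis
    using Q.coset_eq_self_iff[OF B_submodules(3)] carr \<pi>_simps(1) by (simp add: x H_zero)
qed

text \<open>The isomorphism is pinned down by the choice-free \<open>split_rel\<close>, which is
  what makes isomorphisms for different subgroups comparable.\<close>

theorem split_iso:
  "\<exists>\<phi>\<in>module_iso R (HQ k) (module_sum (HC k) (HS (Suc k))). \<forall>x y. split_rel k x y \<longrightarrow> \<phi> x = y"
proof (rule module_iso_of_relation)
  show "split_rel k (x \<oplus>\<^bsub>HQ k\<^esub> x') (y \<oplus>\<^bsub>module_sum (HC k) (HS (Suc k))\<^esub> y')"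
    if xy: "split_rel k x y" and xy': "split_rel k x' y'" for x y x' y'
  proof -
    obtain z c b where D: "split_data k z c b"
      and x: "x = BQ k +>\<^bsub>Q (Suc k)\<^esub> \<pi> (Suc k) (split_cochain k z b)"
      and y: "y = (BC k +>\<^bsub>C (Suc k)\<^esub> z, BS (Suc k) +>\<^bsub>C (Suc (Suc k))\<^esub> c)"
      using xy by (auto simp: split_rel_def)
    obtain z' c' b' where D': "split_data k z' c' b'"
      and x': "x' = BQ k +>\<^bsub>Q (Suc k)\<^esub> \<pi> (Suc k) (split_cochain k z' b')"
      and y': "y' = (BC k +>\<^bsub>C (Suc k)\<^esub> z', BS (Suc k) +>\<^bsub>C (Suc (Suc k))\<^esub> c')"
      using xy' by (auto simp: split_rel_def)
    show ?thesis
      unfolding split_rel_def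
      using split_data_add[OF D D'] split_data_carrier[OF D] split_data_carrier[OF D']
      by (intro exI[of _ "z \<oplus>\<^bsub>C (Suc k)\<^esub> z'"] exI[of _ "c \<oplus>\<^bsub>C (Suc (Suc k))\<^esub> c'"] exI[of _ "b \<oplus>\<^bsub>C (Suc k)\<^esub> b'"])
        (simp add: x x' y y' H_add \<pi>_simps)
  qed
  show "split_rel k (a \<odot>\<^bsub>HQ k\<^esub> x) (a \<odot>\<^bsub>module_sum (HC k) (HS (Suc k))\<^esub> y)"
    if a: "a \<in> carrier R" and xy: "split_rel k x y" for a x y
  proof -
    obtain z c b where D: "split_data k z c b"
      and x: "x = BQ k +>\<^bsub>Q (Suc k)\<^esub> \<pi> (Suc k) (split_cochain k z b)"
      and y: "y = (BC k +>\<^bsub>C (Suc k)\<^esub> z, BS (Suc k) +>\<^bsub>C (Suc (Suc k))\<^esub> c)"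
      using xy by (auto simp: split_rel_def)
    show ?thesis
      unfolding split_rel_def
      using split_data_smult[OF D a] split_data_carrier[OF D] a
      by (intro exI[of _ "a \<odot>\<^bsub>C (Suc k)\<^esub> z"] exI[of _ "a \<odot>\<^bsub>C (Suc (Suc k))\<^esub> c"] exI[of _ "a \<odot>\<^bsub>C (Suc k)\<^esub> b"])
        (simp add: x y H_smult \<pi>_simps)
  qed
qed (fact H_modules module_sum_module[OF H_modules(1,2)] split_rel_carrier split_rel_left split_rel_right
      split_rel_zero_left split_rel_zero_right)+

end

section \<open>Change of coefficients and of groups\<close>

lemma rg_module_subgroup:
  assumes "rg_module R G M act" "subgroup H G"
  shows "rg_module R (G\<lparr>carrier := H\<rparr>) M act"
proof -
  interpret rg_module R G M act by fact
  have "g \<in> H \<Longrightarrow> g \<in> carrier G" for g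
    using subgroup.subset[OF assms(2)] by blast
  then show ?thesis
    using subgroup.subgroup_is_group[OF assms(2)] group_axioms
    by (intro rg_module.intro module_axioms rg_module_axioms.intro)
      (auto simp: act_closed act_add act_smult act_one act_mult)
qed

lemma rg_module_submodule:
  assumes "rg_module R G M act" "rg_submodule N R G M act"
  shows "rg_module R G (M\<lparr>carrier := N\<rparr>) act"
proof -
  interpret rg_module R G M act by fact
  interpret N: rg_submodule N R G M act by fact
  note mem = mem_submodule[OF N.submodule_axioms]
  show ?thesis
    using group_axioms N.submodule_is_module[OF module_axioms]
    by (intro rg_module.intro rg_module_axioms.intro)
      (auto simp: N.act_stable act_add act_smult act_one act_mult mem)
qed

lemma quot_act_coset:
  assumes "rg_module R G M act" "rg_submodule K R G M act" "g \<in> carrier G" "x \<in> carrier M"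
  shows "quot_act M K act g (K +>\<^bsub>M\<^esub> x) = K +>\<^bsub>M\<^esub> act g x"
proof -
  interpret rg_module R G M act by fact
  interpret K: rg_submodule K R G M act by fact
  show ?thesis
    unfolding quot_act_def
    using assms K.act_stable
    by (intro coset_map_coset[OF module_axioms K.submodule_axioms module_axioms K.submodule_axioms] act_hom) auto
qed

lemma rg_module_quot:
  assumes "rg_module R G M act" "rg_submodule K R G M act"
  shows "rg_module R G (quot_module M K) (quot_act M K act)"
proof -
  interpret rg_module R G M act by fact
  interpret K: rg_submodule K R G M act by fact
  have "rg_module_axioms R G (quot_module M K) (quot_act M K act)"
    by (rule rg_module_axioms.intro)
      (auto simp: carrier_quot_module quot_act_coset[OF assms] quot_add[OF K.submodule_axioms]
        quot_smult[OF K.submodule_axioms] act_closed act_add act_smult act_one act_mult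
        simp del: quot_module_simps)
  then show ?thesis
    using group_axioms quot_module_module[OF K.submodule_axioms] by (intro rg_module.intro)
qed

lemma rg_submodule_multiples:
  assumes "rg_module R G M act" "rg_submodule N R G M act"
  shows "rg_submodule (multiples M k N) R G M act"
proof -
  interpret rg_module R G M act by fact
  interpret N: rg_submodule N R G M act by fact
  have eq: "multiples M k N = add_pow M k ` N" by (auto simp: multiples_def)
  have "act g (add_pow M k x) = add_pow M k (act g x)" if "g \<in> carrier G" "x \<in> N" for g x
    using that module_hom_add_pow[OF module_axioms module_axioms act_hom] mem_submodule[OF N.submodule_axioms]
    by blast
  then have "rg_submodule_axioms (multiples M k N) G act"
    using N.act_stable by (intro rg_submodule_axioms.intro) (auto simp: eq)
  then show ?thesis
    using image_submodule[OF module_axioms module_axioms add_pow_hom N.submodule_axioms]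
    by (intro rg_submodule.intro) (simp_all add: eq)
qed

text \<open>Finite sums and additive inverses refer to the carrier of the record, so the equality is
  not a matter of unfolding. It is naturality for the inclusion of \<open>N\<close>.\<close>

lemma coboundary_submodule:
  assumes "rg_module R G M act" "rg_submodule N R G M act" and f: "f \<in> tuples G n \<rightarrow>\<^sub>E N"
  shows "coboundary G (M\<lparr>carrier := N\<rparr>) act n f = coboundary G M act n f"
proof -
  interpret rg_module R G M act by fact
  interpret N: rg_submodule N R G M act by fact
  interpret MN: rg_module R G "M\<lparr>carrier := N\<rparr>" act using assms(1,2) by (rule rg_module_submodule)
  have "(\<lambda>x. x) \<in> module_hom R (M\<lparr>carrier := N\<rparr>) M"
    using mem_submodule[OF N.submodule_axioms] by (intro module_homI) auto
  then have "coboundary G M act n (compose (tuples G n) (\<lambda>x. x) f)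
      = compose (tuples G (Suc n)) (\<lambda>x. x) (coboundary G (M\<lparr>carrier := N\<rparr>) act n f)"
    using f by (intro coboundary_natural[OF MN.rg_module_axioms rg_module_axioms]) auto
  moreover have "compose (tuples G n) (\<lambda>x. x) f = f"
    using f by (auto simp: compose_def PiE_def extensional_restrict)
  moreover have "compose (tuples G (Suc n)) (\<lambda>x. x) (coboundary G (M\<lparr>carrier := N\<rparr>) act n f)
      = coboundary G (M\<lparr>carrier := N\<rparr>) act n f"
    using MN.coboundary_closed[of f n] f by (auto simp: compose_def PiE_def extensional_restrict)
  ultimately show ?thesis by simp
qed

section \<open>Restriction of cochains and classes to subgroups\<close>

lemma tuples_subgroup: "H \<subseteq> carrier G \<Longrightarrow> gs \<in> tuples (G\<lparr>carrier := H\<rparr>) n \<Longrightarrow> gs \<in> tuples G n"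
  by (auto simp: tuples_def)

lemma restrict_hom:
  "H \<subseteq> carrier G \<Longrightarrow>
    (\<lambda>f. restrict f (tuples (G\<lparr>carrier := H\<rparr>) n)) \<in> module_hom R (cochains G M n) (cochains (G\<lparr>carrier := H\<rparr>) M n)"
  by (intro module_homI) (auto simp: cochain_apply tuples_subgroup fun_eq_iff)

context rg_module
begin

lemma coboundary_restrict:
  assumes H: "subgroup H G" and f: "f \<in> carrier (cochains G M n)"
  shows "coboundary (G\<lparr>carrier := H\<rparr>) M act n (restrict f (tuples (G\<lparr>carrier := H\<rparr>) n))
    = restrict (coboundary G M act n f) (tuples (G\<lparr>carrier := H\<rparr>) (Suc n))"
proof -
  let ?H = "G\<lparr>carrier := H\<rparr>"
  interpret H: rg_module R ?H M act using rg_module_axioms H by (rule rg_module_subgroup)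
  have HG: "H \<subseteq> carrier G" using H by (rule subgroup.subset)
  have rf: "restrict f (tuples ?H n) \<in> carrier (cochains ?H M n)"
    using module_hom_closed[OF restrict_hom[OF HG] f] .
  have "merge ?H i gs = merge G i gs" for i gs by (simp add: merge_def)
  then have "face ?H act n i (restrict f (tuples ?H n)) gs = face G act n i f gs" if "gs \<in> tuples ?H (Suc n)" for i gs
    using that tuples_simps[OF that] H.merge_tuples[OF that, of i] by (auto simp: face_def)
  then have "coboundary ?H M act n (restrict f (tuples ?H n)) gs = coboundary G M act n f gs"
    if "gs \<in> tuples ?H (Suc n)" for gs
    using that H.coboundary_eq[OF rf that] coboundary_eq[OF f tuples_subgroup[OF HG that]] by simp
  then show ?thesis
    using H.coboundary_closed[OF rf] module_hom_closed[OF restrict_hom[OF HG] coboundary_closed[OF f]]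
    by (intro PiE_ext[of _ "tuples ?H (Suc n)" "\<lambda>_. carrier M"]) auto
qed

lemma coboundaries_submodule: "submodule (coboundaries G M act (Suc n)) R (cochains G M (Suc n))"
proof -
  note C = cochains_module[OF module_axioms]
  show ?thesis
    using image_submodule[OF C C coboundary_hom module.carrier_is_submodule[OF C]]
    by (simp del: cochains_simps)
qed

text \<open>Restriction commutes with the coboundary and hence preserves coboundaries, so a class
  may be restricted on any representative.\<close>

lemma cohom_res_coset:
  assumes H: "subgroup H G" and f: "f \<in> carrier (cochains G M (Suc n))"
  shows "cohom_res (Suc n) (G\<lparr>carrier := H\<rparr>) M act (coboundaries G M act (Suc n) +>\<^bsub>cochains G M (Suc n)\<^esub> f)
    = coboundaries (G\<lparr>carrier := H\<rparr>) M act (Suc n) +>\<^bsub>cochains (G\<lparr>carrier := H\<rparr>) M (Suc n)\<^esub>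
      restrict f (tuples (G\<lparr>carrier := H\<rparr>) (Suc n))"
proof -
  let ?H = "G\<lparr>carrier := H\<rparr>"
  interpret H: rg_module R ?H M act using rg_module_axioms H by (rule rg_module_subgroup)
  have HG: "H \<subseteq> carrier G" using H by (rule subgroup.subset)
  have "(\<lambda>f. restrict f (tuples ?H (Suc n))) ` coboundaries G M act (Suc n) \<subseteq> coboundaries ?H M act (Suc n)"
  proof (rule image_subsetI)
    fix g assume "g \<in> coboundaries G M act (Suc n)"
    then obtain f where f: "f \<in> carrier (cochains G M n)" "g = coboundary G M act n f"
      unfolding coboundaries.simps by blast
    then show "restrict g (tuples ?H (Suc n)) \<in> coboundaries ?H M act (Suc n)"
      using coboundary_restrict[OF H f(1)] module_hom_closed[OF restrict_hom[OF HG] f(1)]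
      unfolding coboundaries.simps by (metis imageI)
  qed
  then have "coset_map (cochains ?H M (Suc n)) (coboundaries ?H M act (Suc n)) (\<lambda>f. restrict f (tuples ?H (Suc n)))
        (coboundaries G M act (Suc n) +>\<^bsub>cochains G M (Suc n)\<^esub> f)
      = coboundaries ?H M act (Suc n) +>\<^bsub>cochains ?H M (Suc n)\<^esub> restrict f (tuples ?H (Suc n))"
    using f by (intro coset_map_coset[of R] restrict_hom HG cochains_module module_axioms
        coboundaries_submodule H.coboundaries_submodule)
  \<comment> \<open>\<open>cohom_res\<close> works in the module of cocycles, but its cosets are the
    same sets as in all cochains.\<close>
  then show ?thesis
    by (simp add: cohom_res_def coset_map_def a_r_coset_def')
qed

end

section \<open>The natural splitting of cohomology\<close>

text \<open>The order of the group is only required to divide \<open>q\<close>. By Lagrange this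
  passes to subgroups with \<open>u\<close> and \<open>q\<close> unchanged.\<close>

locale rg_splitting = rg_module R G M act + N: rg_submodule N R G M act
  for R :: "('r, 'a) ring_scheme" and G :: "('g, 'b) monoid_scheme"
    and M :: "('r, 'm, 'c) module_scheme" and act :: "'g \<Rightarrow> 'm \<Rightarrow> 'm" and N :: "'m set" +
  fixes u q :: nat
  assumes finite_G: "finite (carrier G)"
    and order_dvd: "order G dvd q"
    and no_torsion: "x \<in> N \<Longrightarrow> add_pow M (u * q * q) x = \<zero>\<^bsub>M\<^esub> \<Longrightarrow> x = \<zero>\<^bsub>M\<^esub>"
begin

abbreviation "K \<equiv> multiples M (u * q * q) N"

lemma K_rg_submodule: "rg_submodule K R G M act"
  using rg_module_axioms N.rg_submodule_axioms by (rule rg_submodule_multiples)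

lemma K_submodule: "submodule K R M"
  using K_rg_submodule by (rule rg_submodule.axioms)

lemma N_carrier: "x \<in> N \<Longrightarrow> x \<in> carrier M"
  using mem_submodule[OF N.submodule_axioms] .

sublocale MN: rg_module R G "M\<lparr>carrier := N\<rparr>" act
  using rg_module_axioms N.rg_submodule_axioms by (rule rg_module_submodule)

sublocale MK: rg_module R G "quot_module M K" "quot_act M K act"
  using rg_module_axioms K_rg_submodule by (rule rg_module_quot)

abbreviation proj :: "nat \<Rightarrow> ('g list \<Rightarrow> 'm) \<Rightarrow> 'g list \<Rightarrow> 'm set" where
  "proj k \<equiv> compose (tuples G k) (\<lambda>x. K +>\<^bsub>M\<^esub> x)"

lemma N_cochain: "f \<in> tuples G k \<rightarrow>\<^sub>E N \<Longrightarrow> f \<in> carrier (cochains G M k)"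
  using N_carrier by auto

lemma N_cochains_submodule: "submodule (tuples G k \<rightarrow>\<^sub>E N) R (cochains G M k)"
proof -
  interpret C: module R "cochains G M k" using module_axioms by (rule cochains_module)
  show ?thesis
    using C.module_incl_imp_submodule cochains_module[OF MN.module_axioms, of G k] N_cochain
    by (auto simp: cochains_submodule)
qed

text \<open>Annihilation is applied with coefficients \<open>N\<close>, so that the primitive takes
  values in \<open>N\<close>; it is then multiplied by the cofactor of the group order in
  \<open>q\<close>.\<close>

lemma N_cochain_annihilate:
  assumes z: "z \<in> tuples G (Suc k) \<rightarrow>\<^sub>E N"
    and dz: "coboundary G M act (Suc k) z = \<zero>\<^bsub>cochains G M (Suc (Suc k))\<^esub>"
  shows "\<exists>y\<in>tuples G k \<rightarrow>\<^sub>E N. add_pow (cochains G M (Suc k)) q z = coboundary G M act k y"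
proof -
  let ?CN = "cochains G (M\<lparr>carrier := N\<rparr>)"
  interpret C: module R "cochains G M j" for j using module_axioms by (rule cochains_module)
  have cob: "coboundary G (M\<lparr>carrier := N\<rparr>) act k f = coboundary G M act k f" if "f \<in> tuples G k \<rightarrow>\<^sub>E N" for f k
    using coboundary_submodule[OF rg_module_axioms N.rg_submodule_axioms that] .
  have "coboundary G (M\<lparr>carrier := N\<rparr>) act (Suc k) z = \<zero>\<^bsub>?CN (Suc (Suc k))\<^esub>" "z \<in> carrier (?CN (Suc k))"
    using cob[OF z] dz z by simp_all
  then obtain y where "y \<in> carrier (?CN k)"
    and y_eq: "add_pow (?CN (Suc k)) (order G) z = coboundary G (M\<lparr>carrier := N\<rparr>) act k y"
    using MN.order_annihilates_cohomology[OF finite_G] by blast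
  then have y: "y \<in> tuples G k \<rightarrow>\<^sub>E N" by simp
  \<comment> \<open>Natural multiples are iterated additions and do not see the carrier.\<close>
  have pow: "add_pow (?CN (Suc k)) j z = add_pow (cochains G M (Suc k)) j z" for j :: nat
    by (simp add: cochains_submodule add_pow_def nat_pow_def)
  obtain j where j: "q = j * order G" using order_dvd by (metis dvd_def mult.commute)
  have "add_pow (cochains G M (Suc k)) q z
      = add_pow (cochains G M (Suc k)) j (add_pow (cochains G M (Suc k)) (order G) z)"
    using N_cochain[OF z] by (simp add: j C.add.nat_pow_pow mult.commute del: cochains_simps)
  also have "\<dots> = coboundary G M act k (add_pow (cochains G M k) j y)"
    using y_eq cob[OF y] pow module_hom_add_pow[OF C.module_axioms C.module_axioms coboundary_hom N_cochain[OF y]]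
    by simp
  finally show ?thesis
    using C.submodule_add_pow[OF N_cochains_submodule y] by blast
qed

section \<open>Projection of cochains to the quotient coefficients\<close>

lemma proj_hom: "proj k \<in> module_hom R (cochains G M k) (cochains G (quot_module M K) k)"
  by (intro module_homI)
    (auto simp: compose_def fun_eq_iff cochain_apply carrier_quot_module quot_add[OF K_submodule]
      quot_smult[OF K_submodule] simp del: quot_module_simps)

lemma proj_surj: "proj k ` carrier (cochains G M k) = carrier (cochains G (quot_module M K) k)"
proof
  show "proj k ` carrier (cochains G M k) \<subseteq> carrier (cochains G (quot_module M K) k)"
    using module_hom_closed[OF proj_hom] by blast
  show "carrier (cochains G (quot_module M K) k) \<subseteq> proj k ` carrier (cochains G M k)"
  proof
    fix F assume F: "F \<in> carrier (cochains G (quot_module M K) k)"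
    then have "\<forall>gs\<in>tuples G k. \<exists>x. x \<in> carrier M \<and> F gs = K +>\<^bsub>M\<^esub> x"
      by (auto simp: carrier_quot_module dest!: PiE_mem)
    from bchoice[OF this] obtain f where f: "\<And>gs. gs \<in> tuples G k \<Longrightarrow> f gs \<in> carrier M \<and> F gs = K +>\<^bsub>M\<^esub> f gs"
      by blast
    then have rf: "restrict f (tuples G k) \<in> carrier (cochains G M k)"
      by auto
    have "F = proj k (restrict f (tuples G k))"
      using F module_hom_closed[OF proj_hom rf] unfolding cochains_simps(1)
      by (rule PiE_ext) (simp add: compose_eq f)
    with rf show "F \<in> proj k ` carrier (cochains G M k)" by blast
  qed
qed

text \<open>Cochains are arbitrary functions on tuples, so preimages in \<open>N\<close> can be
  chosen at each tuple separately.\<close>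

lemma proj_kernel:
  assumes f: "f \<in> carrier (cochains G M k)"
  shows "proj k f = \<zero>\<^bsub>cochains G (quot_module M K) k\<^esub> \<longleftrightarrow>
    (\<exists>s\<in>tuples G k \<rightarrow>\<^sub>E N. f = add_pow (cochains G M k) (u * q * q) s)"
proof -
  have "proj k f = \<zero>\<^bsub>cochains G (quot_module M K) k\<^esub> \<longleftrightarrow> (\<forall>gs\<in>tuples G k. f gs \<in> K)"
    using f coset_eq_self_iff[OF K_submodule] by (auto simp: compose_def fun_eq_iff cochain_apply)
  also have "\<dots> \<longleftrightarrow> (\<exists>s\<in>tuples G k \<rightarrow>\<^sub>E N. f = add_pow (cochains G M k) (u * q * q) s)"
  proof
    assume "\<forall>gs\<in>tuples G k. f gs \<in> K"
    then have "\<forall>gs\<in>tuples G k. \<exists>x. x \<in> N \<and> f gs = add_pow M (u * q * q) x"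
      by (auto simp: multiples_def)
    from bchoice[OF this] obtain s where s: "\<And>gs. gs \<in> tuples G k \<Longrightarrow> s gs \<in> N \<and> f gs = add_pow M (u * q * q) (s gs)"
      by blast
    let ?s = "restrict s (tuples G k)"
    have sN: "?s \<in> tuples G k \<rightarrow>\<^sub>E N" using s by auto
    interpret C: module R "cochains G M k" using module_axioms by (rule cochains_module)
    have "add_pow (cochains G M k) (u * q * q) ?s \<in> carrier (cochains G M k)"
      using N_cochain[OF sN] by (rule C.add.nat_pow_closed)
    then have "f = add_pow (cochains G M k) (u * q * q) ?s"
      using f s cochains_add_pow_apply[OF module_axioms N_cochain[OF sN]]
      by (intro PiE_ext[of _ "tuples G k" "\<lambda>_. carrier M"]) auto
    then show "\<exists>s\<in>tuples G k \<rightarrow>\<^sub>E N. f = add_pow (cochains G M k) (u * q * q) s"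
      using sN by blast
  next
    assume "\<exists>s\<in>tuples G k \<rightarrow>\<^sub>E N. f = add_pow (cochains G M k) (u * q * q) s"
    then show "\<forall>gs\<in>tuples G k. f gs \<in> K"
      using cochains_add_pow_apply[OF module_axioms N_cochain] by (auto simp: multiples_def)
  qed
  finally show ?thesis .
qed

lemma N_cochain_torsion_free:
  assumes s: "s \<in> tuples G k \<rightarrow>\<^sub>E N"
    and eq: "add_pow (cochains G M k) (u * q * q) s = \<zero>\<^bsub>cochains G M k\<^esub>"
  shows "s = \<zero>\<^bsub>cochains G M k\<^esub>"
proof -
  have zero: "s gs = \<zero>\<^bsub>M\<^esub>" if gs: "gs \<in> tuples G k" for gs
  proof (rule no_torsion)
    show "s gs \<in> N" using s gs by (rule PiE_mem)
    show "add_pow M (u * q * q) (s gs) = \<zero>\<^bsub>M\<^esub>"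
      using cochains_add_pow_apply[OF module_axioms N_cochain[OF s] gs, of "u * q * q"] gs
      unfolding eq by simp
  qed
  have "\<zero>\<^bsub>cochains G M k\<^esub> \<in> tuples G k \<rightarrow>\<^sub>E carrier M" by auto
  with N_cochain[OF s, unfolded cochains_simps(1)] show ?thesis
    by (rule PiE_ext) (simp add: zero)
qed

sublocale split: split_complex R "cochains G M" "coboundary G M act" "\<lambda>k. tuples G k \<rightarrow>\<^sub>E N"
  "cochains G (quot_module M K)" "coboundary G (quot_module M K) (quot_act M K act)" proj u q
proof (rule split_complex.intro)
  fix k x
  assume x: "x \<in> tuples G k \<rightarrow>\<^sub>E N"
  show "coboundary G M act k x \<in> tuples G (Suc k) \<rightarrow>\<^sub>E N"
    using MN.coboundary_closed[of x k] x coboundary_submodule[OF rg_module_axioms N.rg_submodule_axioms x]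
    by simp
next
  fix k x
  assume "x \<in> carrier (cochains G M k)"
  then show "proj (Suc k) (coboundary G M act k x) = coboundary G (quot_module M K) (quot_act M K act) k (proj k x)"
    using quot_act_coset[OF rg_module_axioms K_rg_submodule]
    by (intro coboundary_natural[OF rg_module_axioms MK.rg_module_axioms quot_hom[OF K_submodule], symmetric]) simp_all
qed (fact cochains_module[OF module_axioms] coboundary_hom coboundary_coboundary N_cochains_submodule
      cochains_module[OF MK.module_axioms] MK.coboundary_hom proj_hom proj_surj proj_kernel
      N_cochain_torsion_free N_cochain_annihilate)+

lemma B_coboundaries:
  "split.BC k = coboundaries G M act (Suc k)"
  "split.BS k = coboundaries G (M\<lparr>carrier := N\<rparr>) act (Suc k)"
  "split.BQ k = coboundaries G (quot_module M K) (quot_act M K act) (Suc k)"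
  using coboundary_submodule[OF rg_module_axioms N.rg_submodule_axioms]
  by (auto simp: split.BC_def split.BS_def split.BQ_def image_iff cong: bex_cong)

text \<open>These are equalities of records, so \<open>split_iso\<close> speaks literally about
  \<open>cohomology\<close>.\<close>

lemma H_cohomology:
  "split.HC k = cohomology (Suc k) G M act"
  "split.HS k = cohomology (Suc k) G (M\<lparr>carrier := N\<rparr>) act"
  "split.HQ k = cohomology (Suc k) G (quot_module M K) (quot_act M K act)"
proof -
  show "split.HC k = cohomology (Suc k) G M act"
    "split.HQ k = cohomology (Suc k) G (quot_module M K) (quot_act M K act)"
    by (simp_all add: split.HC_def split.HQ_def cohomology_def B_coboundaries split.Z_def split.ZQ_def
        cocycles_def del: cochains_simps coboundaries.simps)
  have "cocycles G (M\<lparr>carrier := N\<rparr>) act k = split.ZS k" for k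
    using coboundary_submodule[OF rg_module_axioms N.rg_submodule_axioms]
    by (auto simp: split.ZS_def cocycles_def)
  then show "split.HS k = cohomology (Suc k) G (M\<lparr>carrier := N\<rparr>) act"
    by (simp add: split.HS_def cohomology_def B_coboundaries cochains_submodule del: coboundaries.simps)
qed

lemma rg_splitting_subgroup:
  assumes H: "subgroup H G"
  shows "rg_splitting R (G\<lparr>carrier := H\<rparr>) M act N u q"
proof -
  have HG: "H \<subseteq> carrier G" using H by (rule subgroup.subset)
  have "rg_submodule N R (G\<lparr>carrier := H\<rparr>) M act"
    using HG N.act_stable by (intro rg_submodule.intro N.submodule_axioms rg_submodule_axioms.intro) auto
  moreover have "card H dvd order G"
    using lagrange[OF H] by (metis dvd_triv_right)
  ultimately show ?thesis
    using rg_module_subgroup[OF rg_module_axioms H] HG finite_G no_torsion order_dvd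
    by (intro rg_splitting.intro rg_splitting_axioms.intro) (auto simp: order_def intro: finite_subset dvd_trans)
qed

text \<open>Naturality on the level of graphs: restriction commutes with coboundaries, multiples and
  projection and preserves values in \<open>N\<close>, so it carries a triple \<open>z\<close>,
  \<open>c\<close>, \<open>b\<close> to a triple for the subgroup with the same \<open>u\<close> and
  \<open>q\<close>.\<close>

lemma split_rel_restrict:
  fixes H
  defines "GH \<equiv> G\<lparr>carrier := H\<rparr>"
  assumes H: "subgroup H G" and xy: "split.split_rel k x y"
  shows "split_complex.split_rel (cochains GH M) (coboundary GH M act) (\<lambda>k. tuples GH k \<rightarrow>\<^sub>E N)
      (cochains GH (quot_module M K)) (coboundary GH (quot_module M K) (quot_act M K act))
      (\<lambda>k. compose (tuples GH k) (\<lambda>x. K +>\<^bsub>M\<^esub> x)) u q k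
    (cohom_res (Suc k) GH (quot_module M K) (quot_act M K act) x)
    (map_prod (cohom_res (Suc k) GH M act) (cohom_res (Suc (Suc k)) GH (M\<lparr>carrier := N\<rparr>) act) y)"
proof -
  interpret H: rg_splitting R GH M act N u q
    unfolding GH_def using H by (rule rg_splitting_subgroup)
  have HG: "H \<subseteq> carrier G" using H by (rule subgroup.subset)
  have sub: "gs \<in> tuples G k" if "gs \<in> tuples GH k" for gs k
    using that tuples_subgroup[OF HG] by (simp add: GH_def)
  let ?r = "\<lambda>k f. restrict f (tuples GH k)"
  have r_hom: "?r k \<in> module_hom R (cochains G M k) (cochains GH M k)" for k
    using restrict_hom[OF HG] by (simp add: GH_def)
  have r_d: "coboundary GH M act k (?r k f) = ?r (Suc k) (coboundary G M act k f)"
    if "f \<in> carrier (cochains G M k)" for f k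
    using coboundary_restrict[OF H that] by (simp add: GH_def)
  have r_zero: "?r k \<zero>\<^bsub>cochains G M k\<^esub> = \<zero>\<^bsub>cochains GH M k\<^esub>" for k
    using module_hom_zero[OF split.C_module H.split.C_module r_hom] .
  have r_pow: "?r k (add_pow (cochains G M k) (j::nat) f) = add_pow (cochains GH M k) j (?r k f)"
    if "f \<in> carrier (cochains G M k)" for f k j
    using module_hom_add_pow[OF split.C_module H.split.C_module r_hom that] .
  have r_N: "?r k f \<in> tuples GH k \<rightarrow>\<^sub>E N" if "f \<in> tuples G k \<rightarrow>\<^sub>E N" for f k
    using that sub by (auto intro: PiE_mem)
  obtain z c b where D: "split.split_data k z c b"
    and x: "x = split.BQ k +>\<^bsub>cochains G (quot_module M K) (Suc k)\<^esub> proj (Suc k) (split.split_cochain k z b)"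
    and y: "y = (split.BC k +>\<^bsub>cochains G M (Suc k)\<^esub> z, split.BS (Suc k) +>\<^bsub>cochains G M (Suc (Suc k))\<^esub> c)"
    using xy unfolding split.split_rel_def by blast
  note carr = split.split_data_carrier[OF D]
  have D': "H.split.split_data k (?r (Suc k) z) (?r (Suc (Suc k)) c) (?r (Suc k) b)"
    using D carr module_hom_closed[OF r_hom] r_d r_zero r_pow r_N
    unfolding H.split.split_data_def split.split_data_def split.Z_def split.ZS_def H.split.Z_def H.split.ZS_def
    by (simp del: cochains_simps)
  have total: "?r (Suc k) (split.split_cochain k z b) = H.split.split_cochain k (?r (Suc k) z) (?r (Suc k) b)"
    using carr split.C.add.nat_pow_closed[OF carr(3)]
    unfolding H.split.split_cochain_def split.split_cochain_def
    by (simp only: module_hom_add[OF r_hom] r_pow)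
  have "cohom_res (Suc k) GH (quot_module M K) (quot_act M K act) x
      = H.split.BQ k +>\<^bsub>cochains GH (quot_module M K) (Suc k)\<^esub> ?r (Suc k) (proj (Suc k) (split.split_cochain k z b))"
    unfolding x B_coboundaries H.B_coboundaries unfolding GH_def
    using carr module_hom_closed[OF proj_hom] by (intro MK.cohom_res_coset[OF H])
  also have "?r (Suc k) (proj (Suc k) (split.split_cochain k z b)) = H.proj (Suc k) (?r (Suc k) (split.split_cochain k z b))"
    using sub by (auto simp: compose_def fun_eq_iff)
  finally have x': "cohom_res (Suc k) GH (quot_module M K) (quot_act M K act) x
      = H.split.BQ k +>\<^bsub>cochains GH (quot_module M K) (Suc k)\<^esub> H.proj (Suc k)
          (H.split.split_cochain k (?r (Suc k) z) (?r (Suc k) b))"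
    unfolding total .
  have z': "cohom_res (Suc k) GH M act (split.BC k +>\<^bsub>cochains G M (Suc k)\<^esub> z)
      = H.split.BC k +>\<^bsub>cochains GH M (Suc k)\<^esub> ?r (Suc k) z"
    unfolding B_coboundaries H.B_coboundaries unfolding GH_def using carr by (intro cohom_res_coset[OF H])
  \<comment> \<open>\<open>split_rel\<close> forms the coset of \<open>c\<close> among cochains in
    \<open>M\<close>, whereas its restriction is computed with coefficients \<open>N\<close>; the
    cosets agree.\<close>
  have coset_N: "B +>\<^bsub>cochains X (M\<lparr>carrier := N\<rparr>) j\<^esub> f = B +>\<^bsub>cochains X M j\<^esub> f"
    for B X j and f :: "'g list \<Rightarrow> 'm"
    by (simp add: cochains_submodule a_r_coset_def')
  have c': "cohom_res (Suc (Suc k)) GH (M\<lparr>carrier := N\<rparr>) act (split.BS (Suc k) +>\<^bsub>cochains G M (Suc (Suc k))\<^esub> c)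
      = H.split.BS (Suc k) +>\<^bsub>cochains GH M (Suc (Suc k))\<^esub> ?r (Suc (Suc k)) c"
    unfolding B_coboundaries H.B_coboundaries coset_N[symmetric] unfolding GH_def
    using D by (intro MN.cohom_res_coset[OF H]) (auto simp: split.split_data_def split.ZS_def)
  show ?thesis
    unfolding H.split.split_rel_def
    by (intro exI conjI, rule D', rule x') (simp only: y map_prod_simp z' c')
qed

end

theorem theorem2p3:
  fixes R :: "('r, 'a) ring_scheme" and G :: "('g, 'b) monoid_scheme"
    and M :: "('r, 'm, 'c) module_scheme" and act :: "'g \<Rightarrow> 'm \<Rightarrow> 'm"
    and N :: "'m set" and p m n r :: nat
  assumes "prime p" and "group G" and "finite (carrier G)" and "order G = p ^ m"
    and "cring R" and "rg_module R G M act" and "rg_submodule N R G M act"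
    and "{x \<in> N. add_pow M p x = \<zero>\<^bsub>M\<^esub>} = {\<zero>\<^bsub>M\<^esub>}"
    and "n \<ge> 1" and "r \<ge> 2 * m"
  defines "K \<equiv> multiples M (p ^ r) N"
  shows "\<exists>\<Phi>.
    (\<forall>H. subgroup H G \<longrightarrow>
       \<Phi> H \<in> module_iso R
         (cohomology n (G\<lparr>carrier := H\<rparr>) (quot_module M K) (quot_act M K act))
         (module_sum (cohomology n (G\<lparr>carrier := H\<rparr>) M act)
                     (cohomology (n + 1) (G\<lparr>carrier := H\<rparr>) (M\<lparr>carrier := N\<rparr>) act))) \<and>
    (\<forall>H H'. subgroup H G \<longrightarrow> subgroup H' (G\<lparr>carrier := H\<rparr>) \<longrightarrow>
       (\<forall>x \<in> carrier (cohomology n (G\<lparr>carrier := H\<rparr>) (quot_module M K) (quot_act M K act)).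
          \<Phi> H' (cohom_res n (G\<lparr>carrier := H'\<rparr>) (quot_module M K) (quot_act M K act) x) =
          map_prod (cohom_res n (G\<lparr>carrier := H'\<rparr>) M act)
                   (cohom_res (n + 1) (G\<lparr>carrier := H'\<rparr>) (M\<lparr>carrier := N\<rparr>) act)
                   (\<Phi> H x)))"
proof -
  \<comment> \<open>The truncated subtraction is exact because \<open>r\<close> is at least
    \<open>2 * m\<close>.\<close>
  define u where "u = p ^ (r - 2 * m)"
  define q where "q = p ^ m"
  have uqq: "p ^ r = u * q * q"
    using assms(10) by (simp add: u_def q_def flip: power_add)
  interpret rg_module R G M act by fact
  interpret N: rg_submodule N R G M act by fact
  have mem: "x \<in> N \<Longrightarrow> x \<in> carrier M" for x
    using mem_submodule[OF N.submodule_axioms] .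
  \<comment> \<open>Factors of \<open>p\<close> are removed one at a time: if the multiple by
    \<open>p ^ Suc j\<close> vanishes, the one by \<open>p ^ j\<close> is a \<open>p\<close>-torsion
    element of \<open>N\<close>.\<close>
  have no_torsion: "x = \<zero>\<^bsub>M\<^esub>" if "x \<in> N" "add_pow M (p ^ j) x = \<zero>\<^bsub>M\<^esub>" for x j
    using that(2)
  proof (induction j)
    case 0
    then show ?case using that(1) mem by simp
  next
    case (Suc j)
    have "add_pow M p (add_pow M (p ^ j) x) = \<zero>\<^bsub>M\<^esub>"
      using Suc.prems that(1) mem by (simp add: M.add.nat_pow_pow mult.commute)
    then have "add_pow M (p ^ j) x = \<zero>\<^bsub>M\<^esub>"
      using assms(8) submodule_add_pow[OF N.submodule_axioms that(1)] by blast
    then show ?case by (rule Suc.IH)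
  qed
  interpret rg_splitting R G M act N u q
  proof (intro rg_splitting.intro rg_splitting_axioms.intro rg_module_axioms N.rg_submodule_axioms)
    show "x = \<zero>\<^bsub>M\<^esub>" if "x \<in> N" "add_pow M (u * q * q) x = \<zero>\<^bsub>M\<^esub>" for x
      using that no_torsion[of x r] unfolding uqq by blast
  qed (simp_all add: assms(3,4) q_def)
  \<comment> \<open>The cohomology modules of the abstract complexes start in degree one, so index
    \<open>k\<close> stands for degree \<open>n\<close>.\<close>
  obtain k where n: "n = Suc k" using assms(9) by (cases n) auto
  have K: "multiples M (u * q * q) N = K" by (simp add: K_def uqq)
  \<comment> \<open>The graph as a function of \<open>H\<close>, so that one choice yields a family
    of isomorphisms with prescribed graphs.\<close>
  define rel where "rel H = split_complex.split_rel (cochains (G\<lparr>carrier := H\<rparr>) M)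
      (coboundary (G\<lparr>carrier := H\<rparr>) M act) (\<lambda>k. tuples (G\<lparr>carrier := H\<rparr>) k \<rightarrow>\<^sub>E N)
      (cochains (G\<lparr>carrier := H\<rparr>) (quot_module M K))
      (coboundary (G\<lparr>carrier := H\<rparr>) (quot_module M K) (quot_act M K act))
      (\<lambda>k. compose (tuples (G\<lparr>carrier := H\<rparr>) k) (\<lambda>x. K +>\<^bsub>M\<^esub> x)) u q k" for H
  have "\<exists>\<phi>. \<phi> \<in> module_iso R
         (cohomology n (G\<lparr>carrier := H\<rparr>) (quot_module M K) (quot_act M K act))
         (module_sum (cohomology n (G\<lparr>carrier := H\<rparr>) M act)
                     (cohomology (n + 1) (G\<lparr>carrier := H\<rparr>) (M\<lparr>carrier := N\<rparr>) act)) \<and>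
       (\<forall>x y. rel H x y \<longrightarrow> \<phi> x = y)" if "subgroup H G" for H
  proof -
    interpret H: rg_splitting R "G\<lparr>carrier := H\<rparr>" M act N u q
      using that by (rule rg_splitting_subgroup)
    show ?thesis
      using H.split.split_iso[of k] unfolding H.H_cohomology unfolding K rel_def n by (simp add: Bex_def)
  qed
  then obtain \<Phi> where \<Phi>: "\<And>H. subgroup H G \<Longrightarrow> \<Phi> H \<in> module_iso R
         (cohomology n (G\<lparr>carrier := H\<rparr>) (quot_module M K) (quot_act M K act))
         (module_sum (cohomology n (G\<lparr>carrier := H\<rparr>) M act)
                     (cohomology (n + 1) (G\<lparr>carrier := H\<rparr>) (M\<lparr>carrier := N\<rparr>) act))"
    and rel: "\<And>H x y. subgroup H G \<Longrightarrow> rel H x y \<Longrightarrow> \<Phi> H x = y"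
    by metis
  have "\<Phi> H' (cohom_res n (G\<lparr>carrier := H'\<rparr>) (quot_module M K) (quot_act M K act) x) =
          map_prod (cohom_res n (G\<lparr>carrier := H'\<rparr>) M act)
                   (cohom_res (n + 1) (G\<lparr>carrier := H'\<rparr>) (M\<lparr>carrier := N\<rparr>) act)
                   (\<Phi> H x)"
    if H: "subgroup H G" and H': "subgroup H' (G\<lparr>carrier := H\<rparr>)"
      and x: "x \<in> carrier (cohomology n (G\<lparr>carrier := H\<rparr>) (quot_module M K) (quot_act M K act))" for H H' x
  proof -
    interpret H: rg_splitting R "G\<lparr>carrier := H\<rparr>" M act N u q
      using H by (rule rg_splitting_subgroup)
    have H'G: "subgroup H' G"
      using H H' by (rule incl_subgroup)
    \<comment> \<open>A partner of \<open>x\<close> over \<open>H\<close> restricts to a partner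
      over \<open>H'\<close>; as each isomorphism is determined on related pairs, the square
      commutes.\<close>
    obtain y where y: "H.split.split_rel k x y"
      using H.split.split_rel_left[of x k] x unfolding H.H_cohomology unfolding K n by blast
    then have "rel H' (cohom_res n (G\<lparr>carrier := H'\<rparr>) (quot_module M K) (quot_act M K act) x)
        (map_prod (cohom_res n (G\<lparr>carrier := H'\<rparr>) M act)
                   (cohom_res (n + 1) (G\<lparr>carrier := H'\<rparr>) (M\<lparr>carrier := N\<rparr>) act) y)"
      using H.split_rel_restrict[OF H' y] by (simp add: rel_def K n)
    moreover have "rel H x y" using y by (simp add: rel_def K)
    ultimately show ?thesis
      using rel[OF H] rel[OF H'G] by simp
  qed
  then show ?thesis using \<Phi> by blast
qed

end
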